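(* Let $\mu$ be a probability measure on $\mathbb{Z}_+=\{0,1,2,\dots\}$ with $0<\mu(0)<1$. If the sequence $(\mu(k))_{k\geq 0}$ is log-concave, then the distributions $(\mathbf{BGW}^{\mu}_n)_{n\geq 1}$ can be coupled as a Markov process $(\mathrm{T}_n)_{n\geq 1}$ (i.e. there is a Markov process $(\mathrm{T}_n)_{n\ge1}$ such that $\mathrm{T}_n$ has law $\mathbf{BGW}^\mu_n$ for every $n\geq 1$) such that $\mathrm{T}_1\subset \mathrm{T}_2\subset \mathrm{T}_3\subset\cdots$.
   Context: Trees. The Ulam--Harris tree is the set of finite words $\mathbb{U}=\bigcup_{h\geq 0}\{1,2,\dots\}^h$; the empty word $\varnothing$ is the root, and for $u\in\mathbb{U}$, $i\ge1$, $ui$ is the word $u$ with letter $i$ appended (the $i$-th child of $u$). A plane tree is a non-empty finite subset $T\subset\mathbb{U}$ such that for all $u\in\mathbb{U}$ and $i\in\{1,2,\dots\}$, $ui\in T$ implies $u\in T$ and $uj\in T$ for all $1\leq j\leq i$. $\mathbb{T}_n$ is the set of plane trees with $n$ vertices (elements). For $T$ a plane tree and $u\in T$, $k_u(T)=\#\{i\ge1: ui\in T\}$ is the number of children of $u$ in $T$. Inclusions between plane trees are inclusions of subsets of $\mathbb{U}$. Conditioned Bienaymé--Galton--Watson distributions. $\mathbf{BGW}^\mu(T)=\prod_{u\in T}\mu(k_u(T))$ for every plane tree $T$, and for $n\geq 1$, when $\mathbf{BGW}^{\mu}(\mathbb{T}_n)>0$, $\mathbf{BGW}^\mu_n$ is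 the probability distribution on $\mathbb{T}_n$ given by $\mathbf{BGW}^\mu_n(T)=\mathbf{BGW}^\mu(T)/\mathbf{BGW}^\mu(\mathbb{T}_n)$. (Under the hypotheses of the claim these are well-defined for all $n\ge 1$.) Log-concavity. A non-negative sequence $(x_i)_{i\geq 0}$ is log-concave if $x_i^2\geq x_{i-1}x_{i+1}$ for all $i\geq 1$ and it has no internal zeros, i.e. $x_ix_j\neq 0$ with $i<j$ implies $x_ix_{i+1}\cdots x_j\neq 0$. A coupling of a family of probability distributions is a family of random variables on a common probability space having these respective laws. Markov processes may be time-inhomogeneous. *)

theory Defs
  imports "HOL-Probability.Probability"
begin

definition ulam_harris :: "nat list set" where
  "ulam_harris = {u. \<forall>i\<in>set u. 1 \<le> i}"

definition plane_tree :: "nat list set \<Rightarrow> bool" where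
  "plane_tree T \<longleftrightarrow> T \<noteq> {} \<and> finite T \<and> T \<subseteq> ulam_harris \<and>
     (\<forall>u\<in>ulam_harris. \<forall>i\<ge>1. u @ [i] \<in> T \<longrightarrow> u \<in> T \<and> (\<forall>j. 1 \<le> j \<and> j \<le> i \<longrightarrow> u @ [j] \<in> T))"

definition plane_trees :: "nat \<Rightarrow> nat list set set" where
  "plane_trees n = {T. plane_tree T \<and> card T = n}"

definition num_children :: "nat list set \<Rightarrow> nat list \<Rightarrow> nat" where
  "num_children T u = card {i. 1 \<le> i \<and> u @ [i] \<in> T}"

definition BGW :: "nat pmf \<Rightarrow> nat list set \<Rightarrow> real" where
  "BGW \<mu> T = (\<Prod>u\<in>T. pmf \<mu> (num_children T u))"

text \<open>The sum below ranges over a finite set, see \<open>finite_plane_trees\<close>. If its value is \<open>0\<close>, then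
  \<open>BGW_cond \<mu> n\<close> is the null measure and hence not the law of any random variable.\<close>

definition BGW_cond :: "nat pmf \<Rightarrow> nat \<Rightarrow> nat list set measure" where
  "BGW_cond \<mu> n =
     point_measure (plane_trees n) (\<lambda>T. ennreal (BGW \<mu> T / (\<Sum>T'\<in>plane_trees n. BGW \<mu> T')))"

definition log_concave :: "(nat \<Rightarrow> real) \<Rightarrow> bool" where
  "log_concave x \<longleftrightarrow> (\<forall>i. 0 \<le> x i) \<and> (\<forall>i\<ge>1. x (i - 1) * x (i + 1) \<le> (x i)\<^sup>2) \<and>
     (\<forall>i j. i < j \<and> x i * x j \<noteq> 0 \<longrightarrow> (\<Prod>k=i..j. x k) \<noteq> 0)"

text \<open>A possibly time-inhomogeneous Markov process indexed by the times \<open>1, 2, \<dots>\<close>, taking values in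
  the countable set \<open>S n\<close> at time \<open>n\<close>. As the state spaces are countable, the Markov property can be
  expressed by elementary conditional probabilities given the past.\<close>

definition markov_process :: "'w measure \<Rightarrow> (nat \<Rightarrow> 's set) \<Rightarrow> (nat \<Rightarrow> 'w \<Rightarrow> 's) \<Rightarrow> bool" where
  "markov_process M S X \<longleftrightarrow> prob_space M \<and>
     (\<forall>n\<ge>1. countable (S n) \<and> X n \<in> measurable M (count_space (S n))) \<and>
     (\<forall>n\<ge>1. \<forall>x y. \<P>(\<omega> in M. \<forall>i\<in>{1..n}. X i \<omega> = x i) > 0 \<longrightarrow>
        \<P>(\<omega> in M. X (Suc n) \<omega> = y \<bar> \<forall>i\<in>{1..n}. X i \<omega> = x i) =
        \<P>(\<omega> in M. X (Suc n) \<omega> = y \<bar> X n \<omega> = x n))"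

lemma plane_tree_prefix:
  assumes "plane_tree T" "u @ v \<in> T"
  shows "u \<in> T"
  using assms(2)
proof (induction v rule: rev_induct)
  case (snoc i v)
  have *: "(u @ v) @ [i] \<in> T" using snoc.prems by simp
  hence "(u @ v) @ [i] \<in> ulam_harris" using assms(1) by (auto simp: plane_tree_def)
  hence "u @ v \<in> ulam_harris" "1 \<le> i" by (auto simp: ulam_harris_def)
  hence "u @ v \<in> T" using * assms(1) unfolding plane_tree_def by blast
  thus ?case by (rule snoc.IH)
qed simp

lemma finite_plane_trees: "finite (plane_trees n)"
proof (rule finite_subset)
  let ?W = "{w. set w \<subseteq> {..n} \<and> length w \<le> n}"
  show "finite (Pow ?W)" using finite_lists_length_le[of "{..n}" n] by simp
  show "plane_trees n \<subseteq> Pow ?W"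
  proof (intro subsetI PowI CollectI conjI)
    fix T w assume "T \<in> plane_trees n" and w: "w \<in> T"
    hence T: "plane_tree T" "card T = n" "finite T" by (auto simp: plane_trees_def plane_tree_def)
    have "card ((\<lambda>k. take k w) ` {..length w}) \<le> card T"
    proof (rule card_mono[OF T(3)])
      show "(\<lambda>k. take k w) ` {..length w} \<subseteq> T"
        using w plane_tree_prefix[OF T(1), of "take k w" "drop k w" for k] by auto
    qed
    moreover have "inj_on (\<lambda>k. take k w) {..length w}"
      by (rule inj_onI) (metis atMost_iff length_take min.absorb2)
    ultimately show "length w \<le> n" using T(2) by (simp add: card_image)
    fix j assume "j \<in> set w"
    then obtain u v where "w = u @ [j] @ v" by (metis append_Cons append_Nil in_set_conv_decomp)
    hence uj: "u @ [j] \<in> T" using w plane_tree_prefix[OF T(1), of "u @ [j]" v] by simp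
    hence "u @ [j] \<in> ulam_harris" using T(1) by (auto simp: plane_tree_def)
    hence "u \<in> ulam_harris" "1 \<le> j" by (auto simp: ulam_harris_def)
    hence "(\<lambda>i. u @ [i]) ` {1..j} \<subseteq> T" using uj T(1) unfolding plane_tree_def by auto
    hence "card ((\<lambda>i. u @ [i]) ` {1..j}) \<le> card T" using T(3) by (rule card_mono[rotated])
    thus "j \<in> {..n}" using T(2) by (simp add: card_image inj_on_def)
  qed
qed

end

theory Submission
  imports Defs
begin

text \<open>
  Write \<open>x = pmf \<mu>\<close>. A coupling of consecutive laws suffices: if every \<open>BGW\<^sub>n\<close> can be coupled with
  \<open>BGW\<^sub>n\<^sub>+\<^sub>1\<close> along inclusion, disintegrating the couplings gives transition kernels, and the resulting
  Markov chain has the required marginals (\<open>rel_pmf_kernelE\<close> and the locale \<open>graded_kernel\<close>).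

  \<^bold>\<open>Reduction to sizes.\<close> A tree with at least two vertices is the pair of the subtree at the first
  child of the root and of the remaining tree. If the root of a tree is weighted by \<open>x (j + k)\<close>
  instead of \<open>x k\<close> when it has \<open>k\<close> children, the first subtree is an ordinary weighted tree and the
  remainder is a tree with root weight shifted by \<open>j + 1\<close>. With \<open>Z j m\<close> the total weight of trees of
  size \<open>m\<close> with shift \<open>j\<close>, the size \<open>A\<^sub>m\<close> of the first subtree has law
  \<open>P (A\<^sub>m = a) = Z 0 a * Z (j + 1) (m - a) / Z j m\<close>, and given \<open>A\<^sub>m\<close> the two parts are independent. By
  induction on the size, for all shifts simultaneously, it suffices to couple \<open>A\<^sub>m\<close> with \<open>A\<^sub>m\<^sub>+\<^sub>1\<close> such
  that \<open>A\<^sub>m\<^sub>+\<^sub>1 - A\<^sub>m\<close> is \<open>0\<close> or \<open>1\<close>: exactly one of the two parts then has to grow by one vertex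
  (\<open>tree_law_increasing\<close>).

  \<^bold>\<open>Coupling the sizes.\<close> Such a coupling exists as soon as \<open>P (A\<^sub>m = a)\<close> dominates both
  \<open>P (A\<^sub>m\<^sub>+\<^sub>1 = a)\<close> and \<open>P (A\<^sub>m\<^sub>+\<^sub>1 = a + 1)\<close> in the range \<open>0 < a < m\<close> (\<open>rel_pmf_stay_or_step\<close>). Both
  inequalities compare growth ratios: \<open>Z i (c + 1) / Z i c \<le> Z j (m + 1) / Z j m\<close> for \<open>0 < c < m\<close> and
  all shifts \<open>i\<close>, \<open>j\<close> (\<open>tree_weight_growth\<close>). The growth ratios \<open>r c = Z 0 (c + 1) / Z 0 c\<close> of
  unshifted trees separate the two sides: the left one is at most \<open>r c\<close>, the right one is at least
  \<open>r (m - 1)\<close>, and \<open>r\<close> is nondecreasing.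

  \<^bold>\<open>Total positivity.\<close> These three facts come from forests. Let \<open>f d n\<close> be the total weight of ordered
  forests of \<open>d\<close> trees with \<open>n\<close> vertices. Removing the root of the first tree is one step of a random
  walk on \<open>d\<close> whose transition matrix has entries \<open>x (e - d + 1)\<close>, and the \<open>2 \<times> 2\<close> minors of that
  matrix are nonnegative exactly because \<open>x\<close> is log-concave. By the Cauchy--Binet formula, the property
  that \<open>f d (n + 1) / f d n\<close> is nondecreasing in \<open>d\<close> propagates from \<open>n\<close> to \<open>n + 1\<close>
  (\<open>forest_weight_likelihood_ratio\<close>). As \<open>Z j (n + 1)\<close> is the mixture of the \<open>f d n\<close> with weights
  \<open>x (j + d)\<close>, while \<open>Z 0 n = f 1 n\<close>, the comparison with \<open>d = 1\<close> gives the lower bound for the growth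
  ratio of \<open>Z j\<close>, hence also the monotonicity of \<open>r\<close>, and Cauchy--Binet once more gives the upper bound.
\<close>

section \<open>Log-concave sequences and minors of order two\<close>

text \<open>The Cauchy--Binet formula for \<open>2 \<times> 2\<close> minors: the difference of the two sides is half the double
  sum over \<open>e\<close>, \<open>e'\<close> of a minor of \<open>(p, q)\<close> times the same minor of \<open>(g, h)\<close>, and each such product is
  nonnegative, being symmetric in \<open>e\<close> and \<open>e'\<close>.\<close>

lemma sum_prod_rearrangement:
  fixes p q g h :: "nat \<Rightarrow> real"
  assumes "\<And>e e'. e \<in> I \<Longrightarrow> e' \<in> I \<Longrightarrow> e < e' \<Longrightarrow> p e' * q e \<le> p e * q e'"
    and "\<And>e e'. e \<in> I \<Longrightarrow> e' \<in> I \<Longrightarrow> e < e' \<Longrightarrow> g e' * h e \<le> g e * h e'"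
  shows "(\<Sum>e\<in>I. q e * g e) * (\<Sum>e\<in>I. p e * h e) \<le> (\<Sum>e\<in>I. p e * g e) * (\<Sum>e\<in>I. q e * h e)"
proof -
  let ?t = "\<lambda>e e'. (p e * q e' - p e' * q e) * (g e * h e' - g e' * h e)"
  have "0 \<le> ?t e e'" if "e \<in> I" "e' \<in> I" for e e'
    using assms(1)[of e e'] assms(1)[of e' e] assms(2)[of e e'] assms(2)[of e' e] that
    by (cases e e' rule: linorder_cases) (auto simp: zero_le_mult_iff mult.commute)
  hence "0 \<le> (\<Sum>e\<in>I. \<Sum>e'\<in>I. ?t e e')" by (intro sum_nonneg) auto
  also have "\<dots> = (\<Sum>e\<in>I. \<Sum>e'\<in>I. (p e * g e) * (q e' * h e')) - (\<Sum>e\<in>I. \<Sum>e'\<in>I. (p e * h e) * (q e' * g e'))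
       - (\<Sum>e\<in>I. \<Sum>e'\<in>I. (q e * g e) * (p e' * h e')) + (\<Sum>e\<in>I. \<Sum>e'\<in>I. (q e * h e) * (p e' * g e'))"
    by (simp only: sum.distrib[symmetric] sum_subtractf[symmetric]) (simp add: algebra_simps)
  also have "\<dots> = 2 * ((\<Sum>e\<in>I. p e * g e) * (\<Sum>e\<in>I. q e * h e) - (\<Sum>e\<in>I. q e * g e) * (\<Sum>e\<in>I. p e * h e))"
    by (simp only: sum_product[symmetric]) (simp add: algebra_simps)
  finally show ?thesis by simp
qed

lemma log_concave_nonneg: "log_concave x \<Longrightarrow> 0 \<le> x i"
  by (simp add: log_concave_def)

lemma log_concave_pos_between:
  assumes "log_concave x" "0 < x a" "0 < x b" "a \<le> k" "k \<le> b"
  shows "0 < x k"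
proof (cases "a < b")
  case True
  moreover have "a < b \<and> x a * x b \<noteq> 0 \<longrightarrow> (\<Prod>k=a..b. x k) \<noteq> 0"
    using assms(1) unfolding log_concave_def by blast
  ultimately have "(\<Prod>k=a..b. x k) \<noteq> 0" using assms(2,3) by simp
  hence "x k \<noteq> 0" using assms(4,5) by (simp add: prod_zero_iff)
  thus ?thesis using log_concave_nonneg[OF assms(1), of k] by simp
next
  case False
  hence "k = a" using assms(4,5) by simp
  thus ?thesis using assms(2) by simp
qed

text \<open>The ratios \<open>x (b + 1) / x b\<close> are nonincreasing. A nonzero left-hand side keeps all the terms between
  its two factors positive, as there are no internal zeros, so that the ratios exist; without that
  condition \<open>1, 0, 0, 1\<close> would be a counterexample.\<close>

lemma log_concave_step:
  assumes x: "log_concave x" and "a \<le> b"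
  shows "x a * x (Suc b) \<le> x (Suc a) * x b"
  using \<open>a \<le> b\<close>
proof (induction b rule: dec_induct)
  case base
  show ?case by (simp add: mult.commute)
next
  case (step b)
  note nn = log_concave_nonneg[OF x]
  show ?case
  proof (cases "x a = 0 \<or> x (Suc (Suc b)) = 0")
    case True
    thus ?thesis using nn by auto
  next
    case False
    hence "0 < x a" "0 < x (Suc (Suc b))" using nn[of a] nn[of "Suc (Suc b)"] by auto
    hence pos: "0 < x b" using step log_concave_pos_between[OF x, of a "Suc (Suc b)" b] by simp
    have "x b * x (Suc (Suc b)) \<le> (x (Suc b))\<^sup>2"
      using x unfolding log_concave_def by (metis Suc_eq_plus1 diff_Suc_1 le_add2)
    hence "x a * (x b * x (Suc (Suc b))) \<le> x a * (x (Suc b))\<^sup>2" using nn by (intro mult_left_mono)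
    also have "\<dots> = (x a * x (Suc b)) * x (Suc b)" by (simp add: power2_eq_square)
    also have "\<dots> \<le> (x (Suc a) * x b) * x (Suc b)" using step.IH nn by (intro mult_right_mono)
    finally have "x b * (x a * x (Suc (Suc b))) \<le> x b * (x (Suc a) * x (Suc b))"
      by (simp add: algebra_simps)
    thus ?thesis using pos by simp
  qed
qed

text \<open>Nonnegativity of all \<open>2 \<times> 2\<close> minors of the Toeplitz matrix of \<open>x\<close>; it telescopes from adjacent
  columns.\<close>

lemma log_concave_shift:
  assumes x: "log_concave x" and "a \<le> b"
  shows "x a * x (b + s) \<le> x (a + s) * x b"
proof (induction s)
  case (Suc s)
  note nn = log_concave_nonneg[OF x]
  show ?case
  proof (cases "x a = 0 \<or> x (b + Suc s) = 0")
    case True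
    thus ?thesis using nn by auto
  next
    case False
    hence "0 < x a" "0 < x (b + Suc s)" using nn[of a] nn[of "b + Suc s"] by auto
    hence "0 < x (a + s)" "0 < x (b + s)"
      using \<open>a \<le> b\<close> log_concave_pos_between[OF x, of a "b + Suc s"] by simp_all
    hence pos: "0 < x (a + s) * x (b + s)" by simp
    have "(x a * x (b + s)) * (x (a + s) * x (Suc (b + s)))
        \<le> (x (a + s) * x b) * (x (Suc (a + s)) * x (b + s))"
      by (rule mult_mono[OF Suc log_concave_step[OF x]]) (simp_all add: nn \<open>a \<le> b\<close>)
    hence "(x (a + s) * x (b + s)) * (x a * x (b + Suc s))
        \<le> (x (a + s) * x (b + s)) * (x (a + Suc s) * x b)" by (simp add: mult_ac)
    thus ?thesis using pos by (simp only: mult_le_cancel_left_pos)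
  qed
qed simp

section \<open>Weights of forests and of trees with shifted root\<close>

text \<open>The total weight of ordered forests of \<open>d\<close> plane trees with \<open>n\<close> vertices in total, where a vertex
  with \<open>k\<close> children has weight \<open>x k\<close>. In the last equation the root of the first tree is removed, which
  puts its \<open>k\<close> subtrees in place of that tree.\<close>

fun forest_weight :: "(nat \<Rightarrow> real) \<Rightarrow> nat \<Rightarrow> nat \<Rightarrow> real" where
  "forest_weight x 0 n = (if n = 0 then 1 else 0)"
| "forest_weight x (Suc d) 0 = 0"
| "forest_weight x (Suc d) (Suc n) = (\<Sum>k\<le>n. x k * forest_weight x (d + k) n)"

text \<open>The total weight of plane trees with \<open>m\<close> vertices when a root with \<open>d\<close> children has weight
  \<open>x (j + d)\<close>: the \<open>d\<close> subtrees at the root form a forest with \<open>m - 1\<close> vertices. The shift \<open>j\<close> counts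
  the children of the root that have been split off already. Only \<open>m \<ge> 1\<close> is meaningful.\<close>

definition tree_weight :: "(nat \<Rightarrow> real) \<Rightarrow> nat \<Rightarrow> nat \<Rightarrow> real" where
  "tree_weight x j m = (\<Sum>d\<le>m - 1. x (j + d) * forest_weight x d (m - 1))"

lemma forest_weight_eq_0: "n < d \<Longrightarrow> forest_weight x d n = 0"
  by (induction x d n rule: forest_weight.induct) auto

lemma forest_weight_nonneg: "(\<And>i. 0 \<le> x i) \<Longrightarrow> 0 \<le> forest_weight x d n"
  by (induction x d n rule: forest_weight.induct) (auto intro!: sum_nonneg)

lemma forest_weight_first_vertex:
  assumes "n \<le> N"
  shows "forest_weight x (Suc d) (Suc n) = (\<Sum>k\<le>N. x k * forest_weight x (d + k) n)"
  unfolding forest_weight.simps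
  by (rule sum.mono_neutral_left) (use assms in \<open>auto simp: forest_weight_eq_0\<close>)

text \<open>The recursion read as a transition from \<open>d + 1\<close> to \<open>e\<close> trees; this is the matrix form to which
  Cauchy--Binet applies.\<close>

lemma forest_weight_transition:
  "forest_weight x (Suc d) (Suc n) = (\<Sum>e\<le>n. (if d \<le> e then x (e - d) else 0) * forest_weight x e n)"
proof -
  have "forest_weight x (Suc d) (Suc n) = (\<Sum>e\<in>{d..d + n}. x (e - d) * forest_weight x e n)"
    unfolding forest_weight.simps
    by (rule sum.reindex_bij_witness[of _ "\<lambda>e. e - d" "\<lambda>k. d + k"]) auto
  also have "\<dots> = (\<Sum>e\<in>{d..d + n}. (if d \<le> e then x (e - d) else 0) * forest_weight x e n)"
    by (rule sum.cong) auto
  also have "\<dots> = (\<Sum>e\<in>{..d + n}. (if d \<le> e then x (e - d) else 0) * forest_weight x e n)"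
    by (rule sum.mono_neutral_left) auto
  also have "\<dots> = (\<Sum>e\<le>n. (if d \<le> e then x (e - d) else 0) * forest_weight x e n)"
    by (rule sum.mono_neutral_right) (auto simp: forest_weight_eq_0)
  finally show ?thesis .
qed

text \<open>Cutting a forest after its first \<open>c\<close> trees. The first of these trees is decomposed at its root, which
  leaves the other \<open>d\<close> trees untouched, so that both sides satisfy the same recursion.\<close>

lemma forest_weight_add:
  "forest_weight x (c + d) n = (\<Sum>a\<le>n. forest_weight x c a * forest_weight x d (n - a))"
proof (induction n arbitrary: c)
  case 0
  show ?case by (cases c) auto
next
  case (Suc n)
  show ?case
  proof (cases c)
    case 0
    thus ?thesis by (subst sum.atMost_Suc_shift) simp
  next
    case (Suc b)
    have "forest_weight x (c + d) (Suc n) = (\<Sum>k\<le>n. x k * forest_weight x ((b + k) + d) n)"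
      using Suc by (simp add: ac_simps)
    also have "\<dots> = (\<Sum>k\<le>n. \<Sum>a\<le>n. x k * forest_weight x (b + k) a * forest_weight x d (n - a))"
      by (simp only: Suc.IH sum_distrib_left mult.assoc)
    also have "\<dots> = (\<Sum>a\<le>n. \<Sum>k\<le>n. x k * forest_weight x (b + k) a * forest_weight x d (n - a))"
      by (rule sum.swap)
    also have "\<dots> = (\<Sum>a\<le>n. forest_weight x c (Suc a) * forest_weight x d (Suc n - Suc a))"
      using Suc by (intro sum.cong) (auto simp: forest_weight_first_vertex[of _ n] sum_distrib_right
          simp del: forest_weight.simps)
    also have "\<dots> = (\<Sum>a\<le>Suc n. forest_weight x c a * forest_weight x d (Suc n - a))"
      using Suc sum.atMost_Suc_shift[of "\<lambda>a. forest_weight x c a * forest_weight x d (Suc n - a)" n]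
      by simp
    finally show ?thesis .
  qed
qed

text \<open>A larger number of trees makes a larger number of vertices relatively more likely. In the induction,
  the rows for \<open>n + 1\<close> and \<open>n + 2\<close> vertices arise from those for \<open>n\<close> and \<open>n + 1\<close> by the same
  transition matrix, whose minors are nonnegative by log-concavity, and Cauchy--Binet carries the sign
  over. For \<open>d = 0\<close> there is no such transition, but the left-hand side vanishes, since the empty forest
  has no vertices.\<close>

lemma forest_weight_likelihood_ratio:
  assumes x: "log_concave x" and "d \<le> d'"
  shows "forest_weight x d' n * forest_weight x d (Suc n) \<le> forest_weight x d n * forest_weight x d' (Suc n)"
  using \<open>d \<le> d'\<close>
proof (induction n arbitrary: d d')
  case 0
  show ?case
  proof (cases d')
    case 0
    thus ?thesis using 0 \<open>d \<le> d'\<close> by simp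
  next
    case (Suc _)
    thus ?thesis using forest_weight_nonneg[of x, OF log_concave_nonneg[OF x]] 
      by (simp del: forest_weight.simps(3))
  qed
next
  case (Suc n)
  show ?case
  proof (cases d)
    case 0
    thus ?thesis by simp
  next
    case (Suc c)
    then obtain c' where c': "d' = Suc c'" "c \<le> c'" using Suc.prems by (cases d') auto
    let ?p = "\<lambda>c e. if c \<le> e then x (e - c) else 0"
    have ext: "forest_weight x (Suc c) (Suc n) = (\<Sum>e\<le>Suc n. ?p c e * forest_weight x e n)" for c
      unfolding forest_weight_transition
      by (rule sum.mono_neutral_left) (auto simp: forest_weight_eq_0)
    show ?thesis
      unfolding Suc c'(1) ext forest_weight_transition[of x _ "Suc n"]
    proof (rule sum_prod_rearrangement)
      fix e e' :: nat assume "e < e'"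
      show "?p c e' * ?p c' e \<le> ?p c e * ?p c' e'"
      proof (cases "c' \<le> e")
        case True
        thus ?thesis using log_concave_shift[OF x, of "e - c'" "e' - c'" "c' - c"] \<open>e < e'\<close> c'(2)
          by (simp add: mult.commute)
      qed (use log_concave_nonneg[OF x] in auto)
      show "forest_weight x e' n * forest_weight x e (Suc n)
          \<le> forest_weight x e n * forest_weight x e' (Suc n)"
        using \<open>e < e'\<close> by (intro Suc.IH) simp
    qed
  qed
qed

lemma tree_weight_nonneg: "(\<And>i. 0 \<le> x i) \<Longrightarrow> 0 \<le> tree_weight x j m"
  unfolding tree_weight_def by (intro sum_nonneg mult_nonneg_nonneg forest_weight_nonneg)

lemma tree_weight_1: "tree_weight x j (Suc 0) = x j"
  by (simp add: tree_weight_def)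

lemma tree_weight_0_eq_forest_weight: "0 < m \<Longrightarrow> tree_weight x 0 m = forest_weight x 1 m"
  by (cases m) (auto simp: tree_weight_def)

text \<open>Splitting off the subtree at the first child of the root: this is \<open>forest_weight_add\<close> with one tree
  in the first group, summed over the number of children of the root.\<close>

lemma tree_weight_rec:
  assumes "2 \<le> m"
  shows "tree_weight x j m = (\<Sum>a=1..<m. tree_weight x 0 a * tree_weight x (Suc j) (m - a))"
proof -
  obtain n where m: "m = Suc (Suc n)" using assms by (metis add_2_eq_Suc less_eqE)
  have rest: "tree_weight x (Suc j) (m - a) = (\<Sum>d\<le>n. x (Suc j + d) * forest_weight x d (Suc n - a))"
    if "a \<in> {1..<m}" for a
    unfolding tree_weight_def
    by (rule sum.mono_neutral_cong_left) (use that m in \<open>auto simp: forest_weight_eq_0\<close>)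
  have "tree_weight x j m = (\<Sum>d\<le>n. x (j + Suc d) * forest_weight x (1 + d) (Suc n))"
    unfolding tree_weight_def m diff_Suc_1 sum.atMost_Suc_shift[of _ n]
    by (simp del: forest_weight.simps(3))
  also have "\<dots> = (\<Sum>d\<le>n. \<Sum>a\<le>Suc n. forest_weight x 1 a * (x (Suc j + d) * forest_weight x d (Suc n - a)))"
    unfolding forest_weight_add by (simp add: sum_distrib_left mult.left_commute del: sum.atMost_Suc)
  also have "\<dots> = (\<Sum>a\<le>Suc n. forest_weight x 1 a * (\<Sum>d\<le>n. x (Suc j + d) * forest_weight x d (Suc n - a)))"
    unfolding sum_distrib_left by (rule sum.swap)
  also have "\<dots> = (\<Sum>a=1..<m. forest_weight x 1 a * (\<Sum>d\<le>n. x (Suc j + d) * forest_weight x d (Suc n - a)))"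
  proof (rule sum.mono_neutral_right)
    have "a = 0" if "a \<le> Suc n" "a \<notin> {1..<m}" for a using that m by auto
    thus "\<forall>a\<in>{..Suc n} - {1..<m}. forest_weight x 1 a * (\<Sum>d\<le>n. x (Suc j + d) * forest_weight x d (Suc n - a)) = 0"
      by force
  qed (use m in auto)
  also have "\<dots> = (\<Sum>a=1..<m. tree_weight x 0 a * tree_weight x (Suc j) (m - a))"
    using rest by (intro sum.cong refl) (auto simp: tree_weight_0_eq_forest_weight)
  finally show ?thesis .
qed

lemma tree_weight_0_pos:
  assumes "\<And>i. 0 \<le> x i" "0 < x 0" "0 < x 1" "0 < m"
  shows "0 < tree_weight x 0 m"
  using \<open>0 < m\<close>
proof (induction m rule: nat_induct_non_zero)
  case 1
  show ?case using assms by (simp add: tree_weight_def)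
next
  case (Suc m)
  have "0 < x 1 * forest_weight x 1 m" using Suc assms by (simp add: tree_weight_0_eq_forest_weight)
  also have "\<dots> \<le> (\<Sum>d\<le>m. x d * forest_weight x d m)"
    by (rule member_le_sum) (use Suc assms forest_weight_nonneg[of x] in auto)
  finally show ?case by (simp add: tree_weight_def)
qed

text \<open>Removing the root leaves \<open>d \<ge> 1\<close> trees with one vertex fewer, and a forest of at least one tree
  has a growth ratio at least that of a single tree of the same size. The removed root is the reason why
  size \<open>m + 1\<close> for the shifted weights is compared with size \<open>m\<close> for the unshifted ones.\<close>

lemma tree_weight_ratio_lower:
  assumes x: "log_concave x" and "0 < m"
  shows "tree_weight x 0 (Suc m) * tree_weight x j (Suc m) \<le> tree_weight x 0 m * tree_weight x j (Suc (Suc m))"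
proof -
  let ?f = "forest_weight x"
  note nn = forest_weight_nonneg[of x, OF log_concave_nonneg[OF x]]
  have "?f 1 (Suc m) * (\<Sum>d\<le>m. x (j + d) * ?f d m) = (\<Sum>d\<le>m. x (j + d) * (?f d m * ?f 1 (Suc m)))"
    by (simp add: sum_distrib_left mult_ac del: forest_weight.simps)
  also have "\<dots> \<le> (\<Sum>d\<le>Suc m. x (j + d) * (?f d m * ?f 1 (Suc m)))"
    using nn log_concave_nonneg[OF x] by (simp del: forest_weight.simps)
  also have "\<dots> \<le> (\<Sum>d\<le>Suc m. x (j + d) * (?f 1 m * ?f d (Suc m)))"
  proof (intro sum_mono mult_left_mono log_concave_nonneg[OF x])
    fix d
    show "?f d m * ?f 1 (Suc m) \<le> ?f 1 m * ?f d (Suc m)"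
    proof (cases "d = 0")
      case False
      thus ?thesis by (intro forest_weight_likelihood_ratio[OF x]) simp
    qed (use nn \<open>0 < m\<close> in simp)
  qed
  also have "\<dots> = ?f 1 m * (\<Sum>d\<le>Suc m. x (j + d) * ?f d (Suc m))"
    by (simp add: sum_distrib_left mult_ac distrib_left del: forest_weight.simps)
  finally show ?thesis
    using \<open>0 < m\<close> unfolding tree_weight_0_eq_forest_weight[OF \<open>0 < m\<close>]
       tree_weight_0_eq_forest_weight[OF zero_less_Suc]
    by (simp add: tree_weight_def del: forest_weight.simps)
qed

text \<open>Shifting the weight of the root makes large root degrees relatively less likely, by log-concavity,
  whereas large trees go along with large root degrees; Cauchy--Binet combines the two.\<close>

lemma tree_weight_ratio_upper:
  assumes x: "log_concave x" and "0 < m"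
  shows "tree_weight x 0 m * tree_weight x j (Suc m) \<le> tree_weight x j m * tree_weight x 0 (Suc m)"
proof -
  obtain n where m: "m = Suc n" using \<open>0 < m\<close> by (cases m) auto
  have ext: "tree_weight x i m = (\<Sum>d\<le>Suc n. x (i + d) * forest_weight x d n)" for i
    by (simp add: tree_weight_def m forest_weight_eq_0)
  have "tree_weight x i (Suc m) = (\<Sum>d\<le>Suc n. x (i + d) * forest_weight x d (Suc n))" for i
    by (simp add: tree_weight_def m)
  thus ?thesis unfolding ext
  proof (simp only:, intro sum_prod_rearrangement)
    fix e e' :: nat assume "e < e'"
    show "x (j + e') * x (0 + e) \<le> x (j + e) * x (0 + e')"
      using log_concave_shift[OF x, of e e' j] \<open>e < e'\<close> by (simp add: ac_simps)
    show "forest_weight x e' n * forest_weight x e (Suc n) \<le> forest_weight x e n * forest_weight x e' (Suc n)"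
      using \<open>e < e'\<close> by (intro forest_weight_likelihood_ratio[OF x]) simp
  qed
qed

text \<open>Log-convexity of the weights of unshifted trees, the case \<open>j = 0\<close> of \<open>tree_weight_ratio_lower\<close>.\<close>

lemma tree_weight_0_ratio_mono:
  assumes x: "log_concave x" "0 < x 0" "0 < x 1" and "0 < c" "c \<le> m"
  shows "tree_weight x 0 (Suc c) / tree_weight x 0 c \<le> tree_weight x 0 (Suc m) / tree_weight x 0 m"
  using \<open>c \<le> m\<close>
proof (induction m rule: dec_induct)
  case (step m)
  have "0 < tree_weight x 0 m" "0 < tree_weight x 0 (Suc m)"
    using step \<open>0 < c\<close> by (auto intro!: tree_weight_0_pos x(2,3) log_concave_nonneg[OF x(1)])
  moreover have "tree_weight x 0 (Suc m) * tree_weight x 0 (Suc m) \<le> tree_weight x 0 m * tree_weight x 0 (Suc (Suc m))"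
    using tree_weight_ratio_lower[OF x(1), of m 0] step \<open>0 < c\<close> by simp
  ultimately have "tree_weight x 0 (Suc m) / tree_weight x 0 m \<le> tree_weight x 0 (Suc (Suc m)) / tree_weight x 0 (Suc m)"
    by (simp add: field_simps)
  thus ?case using step by linarith
qed simp

text \<open>The growth ratio of unshifted trees at sizes between \<open>c\<close> and \<open>m - 1\<close> separates the growth ratio at
  \<open>c\<close> for the shift \<open>i\<close> from the one at \<open>m\<close> for the shift \<open>j\<close>. The ratios are cleared of denominators
  because the weights for large shifts vanish when \<open>x\<close> has bounded support.\<close>

lemma tree_weight_growth:
  assumes x: "log_concave x" "0 < x 0" "0 < x 1" and "0 < c" "c < m"
  shows "tree_weight x i (Suc c) * tree_weight x j m \<le> tree_weight x i c * tree_weight x j (Suc m)"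
proof -
  note nn = tree_weight_nonneg[of x, OF log_concave_nonneg[OF x(1)]]
  obtain l where l: "m = Suc l" "0 < l" "c \<le> l" using assms by (cases m) auto
  define r where "r = tree_weight x 0 (Suc l) / tree_weight x 0 l"
  have pos: "0 < tree_weight x 0 k" if "0 < k" for k
    using that by (auto intro!: tree_weight_0_pos x(2,3) log_concave_nonneg[OF x(1)])
  have "tree_weight x i (Suc c) \<le> tree_weight x i c * (tree_weight x 0 (Suc c) / tree_weight x 0 c)"
    using tree_weight_ratio_upper[OF x(1) \<open>0 < c\<close>, of i] pos[OF \<open>0 < c\<close>] by (simp add: field_simps)
  also have "\<dots> \<le> tree_weight x i c * r"
    unfolding r_def by (intro mult_left_mono tree_weight_0_ratio_mono[OF x] nn l \<open>0 < c\<close>)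
  finally have "tree_weight x i (Suc c) * tree_weight x j m \<le> (tree_weight x i c * r) * tree_weight x j m"
    by (rule mult_right_mono[OF _ nn])
  moreover have "r * tree_weight x j m \<le> tree_weight x j (Suc m)"
    using tree_weight_ratio_lower[OF x(1) \<open>0 < l\<close>, of j] pos[OF \<open>0 < l\<close>]
    by (simp add: field_simps r_def l(1))
  hence "tree_weight x i c * (r * tree_weight x j m) \<le> tree_weight x i c * tree_weight x j (Suc m)"
    by (rule mult_left_mono[OF _ nn])
  ultimately show ?thesis by (simp add: mult.assoc)
qed

section \<open>Coupling two laws on the integers by steps of size at most one\<close>

text \<open>Starting from \<open>a\<close> with law \<open>p\<close>, the mass \<open>u a\<close> by which the distribution function of \<open>p\<close> exceeds
  that of \<open>q\<close> at \<open>a\<close> has to move up from \<open>a\<close> to \<open>a + 1\<close>, and the rest stays. This is possible when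
  \<open>0 \<le> u a \<le> p a\<close>: the first inequality is the sum of the bounds \<open>stay\<close>, the second is the sum of the
  bounds \<open>step\<close> over the upper tail.\<close>

lemma rel_pmf_stay_or_step:
  fixes p q :: "nat pmf"
  assumes p: "set_pmf p \<subseteq> {..<m}" and q: "set_pmf q \<subseteq> {..m}"
    and stay: "\<And>a. a < m \<Longrightarrow> pmf q a \<le> pmf p a"
    and step: "\<And>a. 0 < a \<Longrightarrow> pmf q (Suc a) \<le> pmf p a"
  shows "rel_pmf (\<lambda>a b. b = a \<or> b = Suc a) p q"
proof -
  let ?P = "\<lambda>a. \<Sum>b\<le>a. pmf p b" and ?Q = "\<lambda>a. \<Sum>b\<le>a. pmf q b"
  define u where "u a = ?P a - ?Q a" for a
  have u_nonneg: "0 \<le> u a" for a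
  proof (cases "a < m")
    case True
    thus ?thesis using sum_mono[of "{..a}" "pmf q" "pmf p"] stay by (simp add: u_def)
  next
    case False
    have "?P a = 1" using p False by (intro sum_pmf_eq_1) auto
    moreover have "?Q a \<le> 1" by (simp add: measure_measure_pmf_finite[symmetric])
    ultimately show ?thesis by (simp add: u_def)
  qed
  have u_le: "u a \<le> pmf p a" for a
  proof (cases a)
    case 0
    thus ?thesis by (simp add: u_def)
  next
    case (Suc c)
    have "(\<Sum>b\<in>{a<..a+m}. pmf q b) = (\<Sum>b\<in>{c<..<a+m}. pmf q (Suc b))"
      by (rule sum.reindex_bij_witness[of _ Suc "\<lambda>b. b - 1"]) (auto simp: Suc)
    also have "\<dots> \<le> (\<Sum>b\<in>{c<..<a+m}. pmf p b)"
      by (intro sum_mono step) auto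
    also have "\<dots> \<le> (\<Sum>b\<in>{c<..a+m}. pmf p b)"
      by (intro sum_mono2) auto
    finally have "(\<Sum>b\<in>{a<..a+m}. pmf q b) \<le> (\<Sum>b\<in>{c<..a+m}. pmf p b)" .
    moreover have "?P c + (\<Sum>b\<in>{c<..a+m}. pmf p b) = 1"
      using p by (subst sum.union_disjoint[symmetric]) (auto intro!: sum_pmf_eq_1 simp: Suc)
    moreover have "?Q a + (\<Sum>b\<in>{a<..a+m}. pmf q b) = 1"
      using q by (subst sum.union_disjoint[symmetric]) (auto intro!: sum_pmf_eq_1 simp: Suc)
    ultimately have "?P c \<le> ?Q a" by linarith
    thus ?thesis by (simp add: u_def Suc)
  qed
  define \<kappa> where "\<kappa> a = map_pmf (\<lambda>s. if s then Suc a else a) (bernoulli_pmf (u a / pmf p a))" for a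
  have set_\<kappa>: "set_pmf (\<kappa> a) \<subseteq> {a, Suc a}" for a by (auto simp: \<kappa>_def)
  have inj: "inj (\<lambda>s. if s then Suc a else a)" for a by (auto simp: inj_def)
  have prob: "0 \<le> u a / pmf p a" "u a / pmf p a \<le> 1" for a
    using u_nonneg[of a] u_le[of a] by (auto simp: divide_le_eq_1 intro!: divide_nonneg_nonneg)
  have up: "pmf (\<kappa> a) (Suc a) * pmf p a = u a" for a
    using pmf_map_inj'[OF inj, of a "bernoulli_pmf (u a / pmf p a)" True] prob[of a] u_nonneg[of a] u_le[of a]
    by (auto simp: \<kappa>_def)
  have "pmf (\<kappa> a) a = 1 - u a / pmf p a" for a
    using pmf_map_inj'[OF inj, of a "bernoulli_pmf (u a / pmf p a)" False] prob[of a]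
    by (simp add: \<kappa>_def)
  hence same: "pmf (\<kappa> a) a * pmf p a = pmf p a - u a" for a
    using u_nonneg[of a] u_le[of a] by (cases "pmf p a = 0") (auto simp: left_diff_distrib)
  have "bind_pmf p \<kappa> = q"
  proof (rule pmf_eqI)
    fix b
    have eq: "pmf (bind_pmf p \<kappa>) b = (\<Sum>a\<in>{b - 1, b}. pmf (\<kappa> a) b * pmf p a)"
      unfolding pmf_bind by (rule integral_measure_pmf_real) (use set_\<kappa> in \<open>force simp: set_pmf_iff\<close>)+
    show "pmf (bind_pmf p \<kappa>) b = pmf q b"
    proof (cases b)
      case 0
      thus ?thesis unfolding eq using same[of 0] by (simp add: u_def)
    next
      case (Suc c)
      thus ?thesis unfolding eq using same[of b] up[of c] by (simp add: u_def)
    qed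
  qed
  moreover have "rel_pmf (\<lambda>a b. b = a \<or> b = Suc a) (bind_pmf p return_pmf) (bind_pmf p \<kappa>)"
    by (rule rel_pmf_bindI[where R="(=)"]) (use set_\<kappa> in \<open>auto simp: pmf.rel_eq rel_pmf_return_pmf1\<close>)
  ultimately show ?thesis by (simp add: bind_return_pmf')
qed

section \<open>Random trees built by splitting off the first subtree\<close>

text \<open>A plane tree with at least two vertices is determined by the subtree \<open>s\<close> at the first child of its
  root and the tree \<open>t\<close> that remains when \<open>s\<close> is deleted; it is encoded as \<open>Join s t\<close>. The vertices of
  the plane tree correspond to the leaves of this binary tree.\<close>

datatype ptree = Leaf | Join ptree ptree

fun num_vertices :: "ptree \<Rightarrow> nat" where
  "num_vertices Leaf = 1"
| "num_vertices (Join s t) = num_vertices s + num_vertices t"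

lemma num_vertices_pos: "0 < num_vertices t"
  by (induction t) auto

text \<open>The product of the weights \<open>x k\<close> over all vertices, \<open>k\<close> being the number of children, except that the
  weight of the root is shifted by \<open>j\<close> (\<open>weight_eq_prod_plane\<close>).\<close>

fun weight :: "(nat \<Rightarrow> real) \<Rightarrow> nat \<Rightarrow> ptree \<Rightarrow> real" where
  "weight x j Leaf = x j"
| "weight x j (Join s t) = weight x 0 s * weight x (Suc j) t"

lemma weight_nonneg: "(\<And>i. 0 \<le> x i) \<Longrightarrow> 0 \<le> weight x j t"
  by (induction t arbitrary: j) auto

text \<open>The purpose of this bound is that a tree has weight zero if the total weight for its size vanishes.\<close>

lemma weight_le_tree_weight:
  assumes x: "\<And>i. 0 \<le> x i"
  shows "weight x j t \<le> tree_weight x j (num_vertices t)"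
proof (induction t arbitrary: j)
  case Leaf
  show ?case by (simp add: tree_weight_1)
next
  case (Join s t)
  let ?k = "num_vertices s" and ?l = "num_vertices t"
  have pos: "0 < ?k" "0 < ?l" by (rule num_vertices_pos)+
  have "weight x j (Join s t) \<le> tree_weight x 0 ?k * tree_weight x (Suc j) (?k + ?l - ?k)"
    using Join by (simp add: mult_mono weight_nonneg tree_weight_nonneg x)
  also have "\<dots> \<le> (\<Sum>a=1..<?k + ?l. tree_weight x 0 a * tree_weight x (Suc j) (?k + ?l - a))"
    by (rule member_le_sum) (use pos x in \<open>auto intro!: mult_nonneg_nonneg tree_weight_nonneg\<close>)
  also have "\<dots> = tree_weight x j (num_vertices (Join s t))"
    using pos by (subst tree_weight_rec) auto
  finally show ?case .
qed

text \<open>Inclusion of plane trees in terms of the encoding (\<open>embeds_imp_subset\<close>): the remaining part is itself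
  a tree with the same root, so that new children of the root may only appear after the existing ones.\<close>

inductive embeds :: "ptree \<Rightarrow> ptree \<Rightarrow> bool" where
  "embeds Leaf t"
| "embeds s s' \<Longrightarrow> embeds t t' \<Longrightarrow> embeds (Join s t) (Join s' t')"

lemma embeds_refl: "embeds t t"
  by (induction t) (auto intro: embeds.intros)

text \<open>The law of the size of the first subtree in a random tree of size \<open>m\<close> with shift \<open>j\<close>. By
  \<open>tree_weight_rec\<close> it is a probability mass function if such trees have positive total weight.\<close>

definition split_law :: "(nat \<Rightarrow> real) \<Rightarrow> nat \<Rightarrow> nat \<Rightarrow> nat pmf" where
  "split_law x j m = embed_pmf (\<lambda>a. if 1 \<le> a \<and> a < m
     then tree_weight x 0 a * tree_weight x (Suc j) (m - a) / tree_weight x j m else 0)"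

lemma pmf_split_law:
  assumes x: "\<And>i. 0 \<le> x i" and m: "2 \<le> m" and pos: "0 < tree_weight x j m"
  shows "pmf (split_law x j m) a = (if 1 \<le> a \<and> a < m
     then tree_weight x 0 a * tree_weight x (Suc j) (m - a) / tree_weight x j m else 0)"
  unfolding split_law_def
proof (rule pmf_embed_pmf)
  let ?f = "\<lambda>a. if 1 \<le> a \<and> a < m
    then tree_weight x 0 a * tree_weight x (Suc j) (m - a) / tree_weight x j m else 0"
  show nn: "0 \<le> ?f a" for a using x by (simp add: tree_weight_nonneg)
  have "(\<integral>\<^sup>+a. ennreal (?f a) \<partial>count_space UNIV) = (\<Sum>a=1..<m. ennreal (?f a))"
    by (rule nn_integral_count_space') auto
  also have "\<dots> = ennreal (\<Sum>a=1..<m. ?f a)" by (rule sum_ennreal) (rule nn)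
  also have "(\<Sum>a=1..<m. ?f a) = 1"
    using pos by (simp add: tree_weight_rec[OF m, of x j] flip: sum_divide_distrib)
  finally show "(\<integral>\<^sup>+a. ennreal (?f a) \<partial>count_space UNIV) = 1" by simp
qed

lemma set_split_law:
  assumes x: "\<And>i. 0 \<le> x i" and m: "2 \<le> m" and pos: "0 < tree_weight x j m"
    and a: "a \<in> set_pmf (split_law x j m)"
  shows "0 < a" "a < m" "0 < tree_weight x 0 a" "0 < tree_weight x (Suc j) (m - a)"
proof -
  have *: "1 \<le> a \<and> a < m" "tree_weight x 0 a \<noteq> 0" "tree_weight x (Suc j) (m - a) \<noteq> 0"
    using a by (auto simp: set_pmf_iff pmf_split_law[OF x m pos] split: if_splits)
  thus "0 < a" "a < m" by auto
  show "0 < tree_weight x 0 a" "0 < tree_weight x (Suc j) (m - a)"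
    using * tree_weight_nonneg[of x 0 a, OF x] tree_weight_nonneg[of x "Suc j" "m - a", OF x] by auto
qed

text \<open>The guard \<open>0 < a \<and> a < m\<close>, which makes the sizes decrease, holds on the support of \<open>split_law x j m\<close>
  whenever \<open>tree_weight x j m\<close> is positive (\<open>set_split_law\<close>).\<close>

function tree_law :: "(nat \<Rightarrow> real) \<Rightarrow> nat \<Rightarrow> nat \<Rightarrow> ptree pmf" where
  "tree_law x j m = (if m \<le> 1 then return_pmf Leaf else
     bind_pmf (split_law x j m) (\<lambda>a. if 0 < a \<and> a < m
       then bind_pmf (tree_law x 0 a) (\<lambda>s. map_pmf (Join s) (tree_law x (Suc j) (m - a)))
       else return_pmf Leaf))"
  by pat_completeness auto
termination by (relation "Wellfounded.measure (\<lambda>(x, j, m). m)") auto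

declare tree_law.simps[simp del]

lemma tree_law_1: "tree_law x j (Suc 0) = return_pmf Leaf"
  by (simp add: tree_law.simps)

lemma tree_law_rec:
  assumes "\<And>i. 0 \<le> x i" "2 \<le> m" "0 < tree_weight x j m"
  shows "tree_law x j m = bind_pmf (split_law x j m)
    (\<lambda>a. bind_pmf (tree_law x 0 a) (\<lambda>s. map_pmf (Join s) (tree_law x (Suc j) (m - a))))"
  using assms(2) by (subst tree_law.simps) (auto intro!: bind_pmf_cong dest: set_split_law[OF assms])

lemma pmf_bind_map_Join:
  "pmf (bind_pmf p (\<lambda>s. map_pmf (Join s) q)) (Join s t) = pmf p s * pmf q t"
proof -
  have "pmf (bind_pmf p (\<lambda>s. map_pmf (Join s) q)) (Join s t)
      = (\<Sum>s'\<in>{s}. pmf (map_pmf (Join s') q) (Join s t) * pmf p s')"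
    unfolding pmf_bind by (rule integral_measure_pmf_real) (auto simp: pmf_eq_0_set_pmf)
  also have "\<dots> = pmf p s * pmf q t"
    by (simp add: pmf_map_inj'[of "Join s"] inj_def)
  finally show ?thesis .
qed

text \<open>The recursively sampled tree has the law proportional to \<open>weight x j\<close> on trees of size \<open>m\<close>, because
  the normalising constants of the two parts cancel against the law of the split.\<close>

lemma pmf_tree_law:
  assumes x: "\<And>i. 0 \<le> x i" and "0 < m" "0 < tree_weight x j m"
  shows "pmf (tree_law x j m) t = (if num_vertices t = m then weight x j t / tree_weight x j m else 0)"
  using assms(2,3)
proof (induction t arbitrary: j m)
  case Leaf
  show ?case
  proof (cases "m = 1")
    case True
    thus ?thesis using Leaf by (simp add: tree_law_1 tree_weight_1)
  next
    case False
    hence m: "2 \<le> m" using Leaf by simp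
    have "Leaf \<notin> set_pmf (tree_law x j m)"
      using Leaf m by (auto simp: tree_law_rec[OF x])
    thus ?thesis using False by (simp add: set_pmf_iff)
  qed
next
  case (Join s t)
  show ?case
  proof (cases "m = 1")
    case True
    thus ?thesis using num_vertices_pos[of s] num_vertices_pos[of t] by (simp add: tree_law_1)
  next
    case False
    hence m: "2 \<le> m" using Join by simp
    note split = set_split_law[OF x m Join.prems(2)]
    let ?k = "num_vertices s"
    let ?g = "\<lambda>a. pmf (tree_law x 0 a) s * pmf (tree_law x (Suc j) (m - a)) t"
    have g: "?g a = (if a = ?k \<and> m - a = num_vertices t
        then weight x 0 s / tree_weight x 0 a * (weight x (Suc j) t / tree_weight x (Suc j) (m - a)) else 0)"
      if "a \<in> set_pmf (split_law x j m)" for a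
      using split[OF that] Join.IH by simp
    have "pmf (tree_law x j m) (Join s t) = (\<integral>a. ?g a \<partial>measure_pmf (split_law x j m))"
      by (subst tree_law_rec[OF x m Join.prems(2)]) (simp only: pmf_bind[of "split_law x j m"] pmf_bind_map_Join)
    also have "\<dots> = (\<Sum>a\<in>{?k}. ?g a * pmf (split_law x j m) a)"
      by (rule integral_measure_pmf_real) (use g in \<open>auto split: if_splits\<close>)
    also have "\<dots> = (if num_vertices (Join s t) = m then weight x j (Join s t) / tree_weight x j m else 0)"
    proof (cases "?k \<in> set_pmf (split_law x j m)")
      case True
      note sp = split[OF True]
      have "?g ?k = (if num_vertices (Join s t) = m
          then weight x 0 s / tree_weight x 0 ?k * (weight x (Suc j) t / tree_weight x (Suc j) (m - ?k)) else 0)"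
        unfolding g[OF True] using sp(2) by auto
      moreover have "pmf (split_law x j m) ?k
          = tree_weight x 0 ?k * tree_weight x (Suc j) (m - ?k) / tree_weight x j m"
        unfolding pmf_split_law[OF x m Join.prems(2)] using sp(1,2) by simp
      ultimately show ?thesis using sp(3,4) by simp
    next
      case False
      \<comment> \<open>If the split has probability zero, then one of the two parts has total weight zero.\<close>
      have "weight x j (Join s t) = 0" if nv: "num_vertices (Join s t) = m"
      proof -
        have "1 \<le> ?k \<and> ?k < m" using nv num_vertices_pos[of s] num_vertices_pos[of t] by auto
        hence "tree_weight x 0 ?k * tree_weight x (Suc j) (m - ?k) = 0"
          using False Join.prems(2) by (auto simp: set_pmf_iff pmf_split_law[OF x m Join.prems(2)])
        moreover have "m - ?k = num_vertices t" using nv by simp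
        ultimately show ?thesis
          using weight_le_tree_weight[of x 0 s, OF x] weight_le_tree_weight[of x "Suc j" t, OF x]
            weight_nonneg[of x 0 s, OF x] weight_nonneg[of x "Suc j" t, OF x] by auto
      qed
      thus ?thesis using False by (simp add: set_pmf_iff)
    qed
    finally show ?thesis .
  qed
qed

text \<open>The sizes of the first subtree are coupled by \<open>rel_pmf_stay_or_step\<close>. If that size stays the same,
  the remaining tree must grow by one vertex, otherwise the first subtree must; the part that does not
  grow has the same law on both sides, and the induction hypothesis couples the other one. The shift of
  the remaining tree is \<open>j + 1\<close>, hence the induction for all shifts.\<close>

lemma tree_law_increasing:
  assumes x: "log_concave x" "0 < x 0" "0 < x 1" and "0 < m"
    and "0 < tree_weight x j m" "0 < tree_weight x j (Suc m)"
  shows "rel_pmf embeds (tree_law x j m) (tree_law x j (Suc m))"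
  using assms(4-)
proof (induction m arbitrary: j rule: less_induct)
  case (less m)
  note nn = log_concave_nonneg[OF x(1)]
  show ?case
  proof (cases "m = 1")
    case True
    thus ?thesis by (simp add: tree_law_1 rel_pmf_return_pmf1 embeds.intros)
  next
    case False
    hence m: "2 \<le> m" "2 \<le> Suc m" using less.prems by auto
    let ?p = "split_law x j m" and ?q = "split_law x j (Suc m)"
    note p = set_split_law[OF nn m(1) less.prems(2)] and q = set_split_law[OF nn m(2) less.prems(3)]
    note law = pmf_split_law[OF nn m(1) less.prems(2)] pmf_split_law[OF nn m(2) less.prems(3)]
    have "rel_pmf (\<lambda>a b. b = a \<or> b = Suc a) ?p ?q"
    proof (rule rel_pmf_stay_or_step)
      show "set_pmf ?p \<subseteq> {..<m}" using p by auto
      show "set_pmf ?q \<subseteq> {..m}" using q by force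
    next
      fix a assume "a < m"
      \<comment> \<open>Same first subtree: the remaining tree, of shift \<open>j + 1\<close>, grows more slowly than the whole tree.\<close>
      have "tree_weight x (Suc j) (Suc m - a) * tree_weight x j m
          \<le> tree_weight x (Suc j) (m - a) * tree_weight x j (Suc m)" if "0 < a"
        using tree_weight_growth[OF x, of "m - a" m "Suc j" j] that \<open>a < m\<close> by (simp add: Suc_diff_le)
      hence "tree_weight x 0 a * (tree_weight x (Suc j) (Suc m - a) * tree_weight x j m)
          \<le> tree_weight x 0 a * (tree_weight x (Suc j) (m - a) * tree_weight x j (Suc m))" if "0 < a"
        using that by (intro mult_left_mono tree_weight_nonneg nn)
      thus "pmf ?q a \<le> pmf ?p a" using \<open>a < m\<close> less.prems by (auto simp: law field_simps)
    next
      fix a :: nat assume "0 < a"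
      \<comment> \<open>Same remaining tree: the first subtree, of shift \<open>0\<close>, grows more slowly than the whole tree.\<close>
      have "tree_weight x 0 (Suc a) * tree_weight x j m \<le> tree_weight x 0 a * tree_weight x j (Suc m)" if "a < m"
        using tree_weight_growth[OF x, of a m 0 j] that \<open>0 < a\<close> by simp
      hence "(tree_weight x 0 (Suc a) * tree_weight x j m) * tree_weight x (Suc j) (m - a)
          \<le> (tree_weight x 0 a * tree_weight x j (Suc m)) * tree_weight x (Suc j) (m - a)" if "a < m"
        using that by (intro mult_right_mono tree_weight_nonneg nn)
      thus "pmf ?q (Suc a) \<le> pmf ?p a" using \<open>0 < a\<close> less.prems by (auto simp: law field_simps)
    qed
    hence "rel_pmf (\<lambda>a b. (b = a \<or> b = Suc a) \<and> a \<in> set_pmf ?p \<and> b \<in> set_pmf ?q) ?p ?q"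
      by (rule pmf.rel_mono_strong) auto
    thus ?thesis
      unfolding tree_law_rec[OF nn m(1) less.prems(2)] tree_law_rec[OF nn m(2) less.prems(3)]
    proof (rule rel_pmf_bindI)
      fix a b assume ab: "(b = a \<or> b = Suc a) \<and> a \<in> set_pmf ?p \<and> b \<in> set_pmf ?q"
      hence ab': "b = a \<or> b = Suc a" and "a \<in> set_pmf ?p" "b \<in> set_pmf ?q" by auto
      note a = p[OF \<open>a \<in> set_pmf ?p\<close>] and b = q[OF \<open>b \<in> set_pmf ?q\<close>]
      have s: "rel_pmf embeds (tree_law x 0 a) (tree_law x 0 b)"
      proof (cases "b = a")
        case False
        thus ?thesis using ab' a b less.IH[of a 0] by auto
      qed (auto intro: rel_pmf_reflI embeds_refl)
      have t: "rel_pmf embeds (tree_law x (Suc j) (m - a)) (tree_law x (Suc j) (Suc m - b))"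
      proof (cases "b = a")
        case True
        thus ?thesis using a b less.IH[of "m - a" "Suc j"] by (simp add: Suc_diff_le)
      next
        case False
        thus ?thesis using ab' by (auto intro: rel_pmf_reflI embeds_refl)
      qed
      show "rel_pmf embeds
          (bind_pmf (tree_law x 0 a) (\<lambda>s. map_pmf (Join s) (tree_law x (Suc j) (m - a))))
          (bind_pmf (tree_law x 0 b) (\<lambda>s. map_pmf (Join s) (tree_law x (Suc j) (Suc m - b))))"
        by (rule rel_pmf_bindI[OF s])
           (auto simp: pmf.rel_map intro: embeds.intros pmf.rel_mono_strong[OF t])
    qed
  qed
qed

section \<open>Binary encoding of plane trees\<close>

text \<open>In \<open>Join s t\<close>, the first subtree \<open>s\<close> hangs below the letter \<open>1\<close> and the children of the root of \<open>t\<close>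
  are renumbered from \<open>2\<close> on.\<close>

fun plane :: "ptree \<Rightarrow> nat list set" where
  "plane Leaf = {[]}"
| "plane (Join s t) = {[]} \<union> (#) 1 ` plane s \<union> {Suc i # u |i u. i # u \<in> plane t}"

lemma Nil_in_plane: "[] \<in> plane t"
  by (cases t) auto

lemma Cons_in_plane_Join:
  "i # u \<in> plane (Join s t) \<longleftrightarrow> i = 1 \<and> u \<in> plane s \<or> (\<exists>k. i = Suc k \<and> k # u \<in> plane t)"
  by auto

lemma plane_letters_pos: "i # u \<in> plane t \<Longrightarrow> 0 < i"
  by (induction t arbitrary: i u) auto

lemma one_Cons_in_plane_Join: "1 # u \<in> plane (Join s t) \<longleftrightarrow> u \<in> plane s"
  using plane_letters_pos[of 0 u t] by auto

lemma Suc_Cons_in_plane_Join: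
  "0 < i \<Longrightarrow> Suc i # u \<in> plane (Join s t) \<longleftrightarrow> i # u \<in> plane t"
  by auto

lemma embeds_imp_subset: "embeds s t \<Longrightarrow> plane s \<subseteq> plane t"
proof (induction rule: embeds.induct)
  case (1 t)
  thus ?case using Nil_in_plane by simp
qed auto

lemma inj_plane: "inj plane"
proof (rule injI)
  fix s t assume "plane s = plane t"
  thus "s = t"
  proof (induction s arbitrary: t)
    case Leaf
    thus ?case using one_Cons_in_plane_Join Nil_in_plane by (cases t) force+
  next
    case (Join a b)
    have "[1] \<in> plane t" using Nil_in_plane[of a] unfolding Join.prems[symmetric] by simp
    then obtain c d where t: "t = Join c d" by (cases t) auto
    have "plane a = plane c"
      using Join.prems one_Cons_in_plane_Join[of _ a b] one_Cons_in_plane_Join[of _ c d] t by blast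
    moreover have "u \<in> plane b \<longleftrightarrow> u \<in> plane d" for u
    proof (cases u)
      case (Cons i v)
      show ?thesis
      proof (cases "0 < i")
        case True
        thus ?thesis using Join.prems t Cons Suc_Cons_in_plane_Join[OF True, of v] by metis
      next
        case False
        thus ?thesis using Cons plane_letters_pos by blast
      qed
    qed (simp add: Nil_in_plane)
    ultimately show ?case using Join.IH t by blast
  qed
qed

lemma finite_plane: "finite (plane t)"
proof (induction t)
  case (Join s t)
  have "{Suc i # u |i u. i # u \<in> plane t} \<subseteq> (\<lambda>v. Suc (hd v) # tl v) ` plane t" by force
  hence "finite {Suc i # u |i u. i # u \<in> plane t}"
    by (rule finite_subset) (use Join in simp)
  thus ?case using Join by simp
qed simp

lemma plane_closed:
  assumes "u @ [i] \<in> plane t" "1 \<le> j" "j \<le> i"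
  shows "u \<in> plane t \<and> u @ [j] \<in> plane t"
  using assms
proof (induction t arbitrary: u i j)
  case Leaf
  thus ?case by simp
next
  case (Join s t)
  show ?case
  proof (cases u)
    case Nil
    have "[j] \<in> plane (Join s t)"
    proof (cases "j = 1")
      case True
      thus ?thesis using Nil_in_plane by simp
    next
      case False
      hence j: "j = Suc (j - 1)" "1 \<le> j - 1" using Join.prems by auto
      moreover from j have "[i - 1] \<in> plane t" using Join.prems Nil by (auto simp: Cons_in_plane_Join)
      ultimately have "[j - 1] \<in> plane t" using Join.IH(2)[of "[]" "i - 1" "j - 1"] Join.prems by simp
      thus ?thesis using j by (metis Cons_in_plane_Join)
    qed
    thus ?thesis using Nil Nil_in_plane by simp
  next
    case (Cons k v)
    consider "k = 1" "v @ [i] \<in> plane s" | l where "k = Suc l" "(l # v) @ [i] \<in> plane t"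
      using Join.prems(1) Cons by (auto simp: Cons_in_plane_Join)
    thus ?thesis
    proof cases
      case 1
      thus ?thesis using Join.IH(1)[OF 1(2) Join.prems(2,3)] Cons by (auto simp: Cons_in_plane_Join)
    next
      case 2
      thus ?thesis using Join.IH(2)[OF 2(2) Join.prems(2,3)] Cons by (auto simp: Cons_in_plane_Join)
    qed
  qed
qed

lemma plane_subset_ulam_harris: "plane t \<subseteq> ulam_harris"
  by (induction t) (fastforce simp: ulam_harris_def)+

lemma plane_tree_plane: "plane_tree (plane t)"
  unfolding plane_tree_def
  using Nil_in_plane finite_plane plane_subset_ulam_harris plane_closed by blast

text \<open>The position in \<open>Join s t\<close> of the vertex \<open>v \<noteq> []\<close> of \<open>t\<close>.\<close>

definition next_root_child :: "nat list \<Rightarrow> nat list" where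
  "next_root_child v = Suc (hd v) # tl v"

lemma plane_Join_nonroot:
  "plane (Join s t) - {[]} = (#) 1 ` plane s \<union> next_root_child ` (plane t - {[]})"
  by (auto simp: next_root_child_def image_iff neq_Nil_conv) force+

lemma plane_Join_disjoint: "(#) 1 ` plane s \<inter> next_root_child ` (plane t - {[]}) = {}"
proof -
  have "hd v \<noteq> 0" if "v \<in> plane t - {[]}" for v
    using that plane_letters_pos by (cases v) auto
  thus ?thesis by (fastforce simp: next_root_child_def)
qed

lemma inj_on_next_root_child: "inj_on next_root_child (A - {[]})"
  by (auto simp: inj_on_def next_root_child_def neq_Nil_conv)

lemma card_plane: "card (plane t) = num_vertices t"
proof (induction t)
  case (Join s t)
  have card: "card (plane u) = Suc (card (plane u - {[]}))" for u
    using card.remove[OF finite_plane Nil_in_plane] .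
  have "card (plane (Join s t) - {[]}) = card (plane s) + card (plane t - {[]})"
    unfolding plane_Join_nonroot
    by (subst card_Un_disjoint[OF _ _ plane_Join_disjoint])
       (simp_all add: finite_plane card_image inj_on_next_root_child)
  thus ?case using card[of "Join s t"] card[of t] Join by simp
qed simp

lemma num_children_Join_root:
  "num_children (plane (Join s t)) [] = Suc (num_children (plane t) [])"
proof -
  let ?A = "{i. 1 \<le> i \<and> [] @ [i] \<in> plane t}"
  have "finite ?A"
    by (rule finite_subset[OF _ finite_imageI[OF finite_plane[of t], of hd]]) force
  moreover have "{i. 1 \<le> i \<and> [] @ [i] \<in> plane (Join s t)} = insert 1 (Suc ` ?A)"
    using Nil_in_plane plane_letters_pos by (auto simp: Cons_in_plane_Join image_iff)
  moreover have "1 \<notin> Suc ` ?A" by auto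
  ultimately show ?thesis
    by (simp add: num_children_def card_image del: plane.simps)
qed

lemma num_children_Join_first:
  "num_children (plane (Join s t)) (1 # u) = num_children (plane s) u"
  using one_Cons_in_plane_Join[of _ s t] by (simp add: num_children_def del: plane.simps)

lemma num_children_Join_rest:
  assumes "v \<in> plane t - {[]}"
  shows "num_children (plane (Join s t)) (next_root_child v) = num_children (plane t) v"
proof -
  obtain i u where "v = i # u" "0 < i" using assms plane_letters_pos by (cases v) auto
  thus ?thesis using Suc_Cons_in_plane_Join[of i _ s t]
    by (simp add: num_children_def next_root_child_def del: plane.simps)
qed

text \<open>The children of a vertex other than the root are the same in \<open>Join s t\<close> as in the part which contains
  it, and the root of \<open>t\<close> acquires one more child; the shift \<open>j + 1\<close> accounts for that child.\<close>

lemma weight_eq_prod_plane: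
  "weight x j t = x (j + num_children (plane t) []) * (\<Prod>u\<in>plane t - {[]}. x (num_children (plane t) u))"
proof (induction t arbitrary: j)
  case Leaf
  show ?case by (simp add: num_children_def)
next
  case (Join s t)
  let ?T = "plane (Join s t)"
  have "(\<Prod>u\<in>?T - {[]}. x (num_children ?T u))
      = (\<Prod>u\<in>plane s. x (num_children ?T (1 # u))) * (\<Prod>v\<in>plane t - {[]}. x (num_children ?T (next_root_child v)))"
    unfolding plane_Join_nonroot
    by (subst prod.union_disjoint[OF _ _ plane_Join_disjoint])
       (simp_all add: finite_plane prod.reindex inj_on_next_root_child)
  also have "\<dots> = (\<Prod>u\<in>plane s. x (num_children (plane s) u)) * (\<Prod>v\<in>plane t - {[]}. x (num_children (plane t) v))"
    by (simp only: num_children_Join_first num_children_Join_rest cong: prod.cong)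
  also have "(\<Prod>u\<in>plane s. x (num_children (plane s) u)) = weight x 0 s"
    unfolding Join.IH(1) by (simp add: prod.remove[OF finite_plane Nil_in_plane])
  finally show ?case by (simp add: Join.IH(2)[of "Suc j"] num_children_Join_root del: plane.simps)
qed

lemma BGW_plane: "BGW \<mu> (plane t) = weight (pmf \<mu>) 0 t"
  by (simp add: BGW_def weight_eq_prod_plane prod.remove[OF finite_plane Nil_in_plane])

text \<open>The decoded parts of \<open>T\<close> are the subtree \<open>S\<close> at the vertex \<open>1\<close> and the tree \<open>R\<close> obtained by
  deleting that subtree and decreasing the first letters by one. Both are smaller: \<open>S\<close> omits the root,
  and \<open>R\<close> omits the vertex \<open>1\<close>.\<close>

lemma plane_surj:
  assumes "plane_tree T"
  shows "\<exists>t. plane t = T"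
  using assms
proof (induction "card T" arbitrary: T rule: less_induct)
  case less
  hence fin: "finite T" and ne: "T \<noteq> {}" and uh: "T \<subseteq> ulam_harris"
    by (auto simp: plane_tree_def)
  have closed: "u @ [j] \<in> T" if "u @ [i] \<in> T" "1 \<le> j" "j \<le> i" for u i j
  proof -
    have "u @ [i] \<in> ulam_harris" using that(1) uh by blast
    hence "u \<in> ulam_harris" "1 \<le> i" by (auto simp: ulam_harris_def)
    thus ?thesis using less.prems that unfolding plane_tree_def by blast
  qed
  have prefix: "u \<in> T" if "u @ v \<in> T" for u v using plane_tree_prefix[OF less.prems that] .
  have pos: "0 < i" if "u @ i # v \<in> T" for u i v using uh that by (force simp: ulam_harris_def)
  have root: "[] \<in> T" using ne prefix[of "[]"] by auto
  show ?case
  proof (cases "T = {[]}")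
    case True
    thus ?thesis by (intro exI[of _ Leaf]) simp
  next
    case False
    then obtain v where "v \<in> T" "v \<noteq> []" using root by blast
    then obtain i u where iu: "i # u \<in> T" by (cases v) auto
    hence one: "[1] \<in> T" using prefix[of "[i]" u] closed[of "[]" i 1] pos[of "[]" i u] by simp
    define S where "S = {u. 1 # u \<in> T}"
    define R where "R = {[]} \<union> {i # u |i u. 0 < i \<and> Suc i # u \<in> T}"
    have R_Cons: "i # u \<in> R \<longleftrightarrow> 0 < i \<and> Suc i # u \<in> T" for i u by (simp add: R_def)
    have S_sub: "(#) 1 ` S \<subseteq> T - {[]}" by (auto simp: S_def)
    have "finite S" by (rule finite_imageD[OF finite_subset[OF S_sub]]) (use fin in auto)
    have "card S < card T"
      using card_mono[OF _ S_sub] card.remove[OF fin root] fin by (simp add: card_image)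
    define f where "f v = (if v = [] then [] else next_root_child v)" for v
    have R_sub: "f ` R \<subseteq> T - {[1]}"
      using root by (auto simp: R_def f_def next_root_child_def)
    have inj: "inj_on f R" by (auto simp: inj_on_def f_def next_root_child_def neq_Nil_conv)
    have "finite R" by (rule finite_imageD[OF finite_subset[OF R_sub] inj]) (use fin in auto)
    have "card R < card T"
      using card_mono[OF _ R_sub] card.remove[OF fin one] fin card_image[OF inj] by simp
    have "plane_tree S" unfolding plane_tree_def
    proof (intro conjI ballI allI impI)
      show "S \<noteq> {}" using one by (auto simp: S_def)
      show "S \<subseteq> ulam_harris" using uh by (auto simp: S_def ulam_harris_def)
      fix u i assume "u @ [i] \<in> S"
      thus "u \<in> S" using prefix[of "1 # u" "[i]"] by (simp add: S_def)
      fix j assume "1 \<le> j \<and> j \<le> i"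
      thus "u @ [j] \<in> S" using closed[of "1 # u" i j] \<open>u @ [i] \<in> S\<close> by (simp add: S_def)
    qed fact
    moreover have "plane_tree R" unfolding plane_tree_def
    proof (intro conjI ballI allI impI)
      show "R \<noteq> {}" by (simp add: R_def)
      show "R \<subseteq> ulam_harris" using uh by (force simp: R_def ulam_harris_def)
      fix u i assume ui: "u @ [i] \<in> R"
      thus "u \<in> R" using prefix[of "Suc (hd u) # tl u" "[i]"] 
        by (cases u) (simp_all add: R_Cons, simp add: R_def)
      fix j assume "1 \<le> j \<and> j \<le> i"
      thus "u @ [j] \<in> R" using ui closed[of "Suc (hd u) # tl u" i j] closed[of "[]" "Suc i" "Suc j"]
        by (cases u) (simp_all add: R_Cons)
    qed fact
    ultimately obtain s t where st: "plane s = S" "plane t = R"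
      using less.hyps \<open>card S < card T\<close> \<open>card R < card T\<close> by blast
    have "u \<in> plane (Join s t) \<longleftrightarrow> u \<in> T" for u
    proof (cases u)
      case Nil
      thus ?thesis using root by simp
    next
      case (Cons i v)
      show ?thesis
      proof (cases "i = 1")
        case True
        thus ?thesis using Cons one_Cons_in_plane_Join[of v s t] st by (simp add: S_def)
      next
        case False
        thus ?thesis using Cons st pos[of "[]" i v] by (cases i) (auto simp: Cons_in_plane_Join R_Cons)
      qed
    qed
    thus ?thesis by blast
  qed
qed

lemma plane_trees_eq_image: "plane_trees n = plane ` {t. num_vertices t = n}"
proof (intro equalityI subsetI)
  fix T assume "T \<in> plane_trees n"
  hence "plane_tree T" "card T = n" by (auto simp: plane_trees_def)
  then obtain t where "plane t = T" using plane_surj by blast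
  thus "T \<in> plane ` {t. num_vertices t = n}" using \<open>card T = n\<close> card_plane[of t] by auto
qed (auto simp: plane_trees_def plane_tree_plane card_plane)

section \<open>Markov chains from independent successors\<close>

text \<open>Disintegration of a coupling: the kernel is the conditional law of the second component given the
  first one.\<close>

lemma rel_pmf_kernelE:
  assumes "rel_pmf R p q"
  obtains k where "bind_pmf p k = q" "\<And>x y. x \<in> set_pmf p \<Longrightarrow> y \<in> set_pmf (k x) \<Longrightarrow> R x y"
proof -
  obtain pq where pq: "\<And>x y. (x, y) \<in> set_pmf pq \<Longrightarrow> R x y" "map_pmf fst pq = p" "map_pmf snd pq = q"
    using assms by (auto elim: rel_pmf.cases)
  have ne: "set_pmf pq \<inter> {z. fst z = x} \<noteq> {}" if "x \<in> set_pmf p" for x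
    using that unfolding pq(2)[symmetric] by auto
  define k where "k x = map_pmf snd (cond_pmf pq {z. fst z = x})" for x
  have "bind_pmf p (\<lambda>x. cond_pmf pq {z. fst z = x}) = pq"
  proof (rule bind_cond_pmf_cancel)
    fix z assume "z \<in> set_pmf pq"
    thus "set_pmf p \<inter> {x. fst z = x} \<noteq> {}" unfolding pq(2)[symmetric] by auto
  next
    fix x z assume "x \<in> set_pmf p" "z \<in> set_pmf pq" "fst z = x"
    have "measure_pmf.prob p {x. fst z = x} = measure_pmf.prob pq (fst -` {x. fst z = x})"
      unfolding pq(2)[symmetric] by simp
    also have "fst -` {x. fst z = x} = {z. fst z = x}" using \<open>fst z = x\<close> by auto
    finally show "measure_pmf.prob pq {z. fst z = x} = measure_pmf.prob p {x. fst z = x}" ..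
  qed (use ne in auto)
  hence "bind_pmf p k = q" unfolding k_def map_bind_pmf[symmetric] by (simp add: pq(3))
  moreover have "R x y" if "x \<in> set_pmf p" "y \<in> set_pmf (k x)" for x y
    using that(2) ne[OF that(1)] by (auto simp: k_def set_cond_pmf intro: pq(1))
  ultimately show thesis by (rule that)
qed

text \<open>Laws \<open>P n\<close> on pairwise disjoint finite state spaces \<open>S n\<close>, linked by a transition kernel \<open>K\<close>. As the
  state determines the time, a single kernel describes a time-inhomogeneous chain, and no state is ever
  visited twice. Hence the chain can be driven by a family of independent successors, one drawn in
  advance for each state, and it is a function of a random element of a countable product space. The
  numbering \<open>code\<close> of the states lets the sample points be sequences of states.\<close>

locale graded_kernel =
  fixes P :: "nat \<Rightarrow> 's pmf" and K :: "'s \<Rightarrow> 's pmf" and S :: "nat \<Rightarrow> 's set"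
    and code :: "'s \<Rightarrow> nat" and decode :: "nat \<Rightarrow> 's" and root :: 's
  assumes law_1: "P 1 = return_pmf root"
    and law_Suc: "\<And>n. 1 \<le> n \<Longrightarrow> bind_pmf (P n) K = P (Suc n)"
    and law_support: "\<And>n. 1 \<le> n \<Longrightarrow> set_pmf (P n) \<subseteq> S n"
    and finite_states: "\<And>n. finite (S n)"
    and disjoint_states: "\<And>m n x. x \<in> S m \<Longrightarrow> x \<in> S n \<Longrightarrow> m = n"
    and decode: "\<And>n x. x \<in> S n \<Longrightarrow> decode (code x) = x"
begin

text \<open>The component spaces are cut down to the supports, so that every sample point, and not only almost
  every one, yields possible transitions.\<close>

definition successor :: "nat \<Rightarrow> 's measure" where
  "successor k = restrict_space (measure_pmf (K (decode k))) (set_pmf (K (decode k)))"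

definition M :: "(nat \<Rightarrow> 's) measure" where
  "M = PiM UNIV successor"

definition X :: "nat \<Rightarrow> (nat \<Rightarrow> 's) \<Rightarrow> 's" where
  "X n \<omega> = ((\<lambda>x. \<omega> (code x)) ^^ (n - 1)) root"

lemma X_1: "X (Suc 0) \<omega> = root"
  by (simp add: X_def)

lemma X_Suc: "1 \<le> n \<Longrightarrow> X (Suc n) \<omega> = \<omega> (code (X n \<omega>))"
  by (cases n) (simp_all add: X_def)

lemma space_successor: "space (successor k) = set_pmf (K (decode k))"
  by (simp add: successor_def space_restrict_space)

lemma sets_successor: "sets (successor k) = Pow (set_pmf (K (decode k)))"
  by (auto simp: successor_def sets_restrict_space)

lemma measure_successor: "measure (successor k) (A \<inter> set_pmf (K (decode k))) = measure (K (decode k)) A"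
  unfolding successor_def by (simp add: measure_restrict_space measure_Int_set_pmf)

lemma prob_space_successor: "prob_space (successor k)"
  unfolding successor_def
  by (intro prob_space_restrict_space measure_pmf.emeasure_eq_1_AE) (auto simp: AE_measure_pmf_iff)

sublocale prod: product_prob_space successor UNIV
  by (simp add: product_prob_space_def product_prob_space_axioms_def product_sigma_finite_def
      prob_space_successor prob_space_imp_sigma_finite)

sublocale M: prob_space M
  unfolding M_def by (rule prob_space_PiM) (rule prob_space_successor)

lemma space_M: "\<omega> \<in> space M \<longleftrightarrow> (\<forall>k. \<omega> k \<in> set_pmf (K (decode k)))"
  by (auto simp: M_def space_PiM space_successor)

lemma X_in_support:
  assumes "\<omega> \<in> space M" "1 \<le> n"
  shows "X n \<omega> \<in> set_pmf (P n)"
  using \<open>1 \<le> n\<close>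
proof (induction n rule: dec_induct)
  case base
  show ?case using law_1 by (simp add: X_1)
next
  case (step n)
  have "decode (code (X n \<omega>)) = X n \<omega>"
    using step law_support by (blast intro: decode)
  hence "X (Suc n) \<omega> \<in> set_pmf (K (X n \<omega>))"
    using assms(1) step(1) unfolding space_M by (metis X_Suc)
  thus ?case using step by (auto simp: law_Suc[symmetric])
qed

lemma X_in_states: "\<omega> \<in> space M \<Longrightarrow> 1 \<le> n \<Longrightarrow> X n \<omega> \<in> S n"
  using X_in_support law_support by blast

lemma X_Suc_in_kernel:
  assumes "\<omega> \<in> space M" "1 \<le> n"
  shows "X (Suc n) \<omega> \<in> set_pmf (K (X n \<omega>))"
  using assms decode[OF X_in_states[OF assms]] unfolding space_M by (metis X_Suc)

lemma measurable_X:
  assumes "1 \<le> n"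
  shows "X n \<in> measurable M (count_space (S n))"
  using assms
proof (induction n rule: dec_induct)
  case base
  have "root \<in> S 1" using law_support[of 1] law_1 by simp
  moreover have "X 1 = (\<lambda>_. root)" by (auto simp: X_1)
  ultimately show ?case by (simp del: One_nat_def)
next
  case (step n)
  have "(\<lambda>\<omega>. \<omega> (code x)) \<in> measurable M (count_space UNIV)" for x
  proof -
    have "(\<lambda>\<omega>. \<omega> (code x)) \<in> measurable M (successor (code x))"
      unfolding M_def by (rule measurable_component_singleton) simp
    moreover have "(\<lambda>z. z) \<in> measurable (successor (code x)) (count_space UNIV)"
      by (rule measurableI) (auto simp: sets_successor space_successor)
    ultimately show ?thesis by (rule measurable_compose)
  qed
  hence "(\<lambda>\<omega>. \<omega> (code (X n \<omega>))) \<in> measurable M (count_space UNIV)"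
    by (rule measurable_compose_countable'[OF _ step.IH]) (simp add: finite_states countable_finite)
  hence meas: "X (Suc n) \<in> measurable M (count_space UNIV)"
    using X_Suc[OF step(1)] by (simp cong: measurable_cong)
  have "X (Suc n) -` {a} \<inter> space M \<in> sets M" for a
    by (rule measurable_sets[OF meas]) simp
  thus ?case using X_in_states by (auto simp: measurable_count_space_eq2 finite_states)
qed

lemma sets_X: "1 \<le> n \<Longrightarrow> {\<omega> \<in> space M. X n \<omega> = y} \<in> sets M"
proof -
  assume n: "1 \<le> n"
  have "{\<omega> \<in> space M. X n \<omega> = y} = X n -` ({y} \<inter> S n) \<inter> space M" using X_in_states n by auto
  thus ?thesis using measurable_sets[OF measurable_X[OF n], of "{y} \<inter> S n"] by simp
qed

lemma sets_path: "{\<omega> \<in> space M. \<forall>i\<in>{1..n}. X i \<omega> = x i} \<in> sets M"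
  by (rule sets.sets_Collect_finite_All) (auto intro: sets_X)

lemma path_iff:
  assumes "x 1 = root" "1 \<le> n"
  shows "(\<forall>i\<in>{1..n}. X i \<omega> = x i) \<longleftrightarrow> (\<forall>i\<in>{1..<n}. \<omega> (code (x i)) = x (Suc i))"
  using \<open>1 \<le> n\<close>
proof (induction n rule: dec_induct)
  case base
  show ?case using assms(1) by (simp add: X_1)
next
  case (step n)
  have "(\<forall>i\<in>{1..Suc n}. X i \<omega> = x i) \<longleftrightarrow> (\<forall>i\<in>{1..n}. X i \<omega> = x i) \<and> \<omega> (code (x n)) = x (Suc n)"
    using step(1) X_Suc[OF step(1)] by (auto simp: atLeastAtMostSuc_conv)
  also have "\<dots> \<longleftrightarrow> (\<forall>i\<in>{1..<Suc n}. \<omega> (code (x i)) = x (Suc i))"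
    unfolding step.IH using step(1) by (auto simp: atLeastLessThanSuc)
  finally show ?case .
qed

text \<open>The event that the chain starts along \<open>x 1, \<dots>, x n\<close> only depends on the successors of
  \<open>x 1, \<dots>, x (n - 1)\<close>, and the next step is the successor of \<open>x n\<close>. These states are distinct, so
  the product measure makes the next step independent of the past.\<close>

lemma prob_path_step:
  assumes n: "1 \<le> n"
  shows "measure M {\<omega> \<in> space M. (\<forall>i\<in>{1..n}. X i \<omega> = x i) \<and> X (Suc n) \<omega> = y}
    = measure M {\<omega> \<in> space M. \<forall>i\<in>{1..n}. X i \<omega> = x i} * pmf (K (x n)) y"
proof (cases "x 1 = root \<and> (\<forall>i\<in>{1..n}. x i \<in> S i)")
  case False
  hence "\<not> (\<forall>i\<in>{1..n}. X i \<omega> = x i)" if "\<omega> \<in> space M" for \<omega>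
    using X_in_states[OF that] n X_1 by (metis One_nat_def atLeastAtMost_iff order_refl)
  hence "{\<omega> \<in> space M. \<forall>i\<in>{1..n}. X i \<omega> = x i} = {}"
    "{\<omega> \<in> space M. (\<forall>i\<in>{1..n}. X i \<omega> = x i) \<and> X (Suc n) \<omega> = y} = {}" by blast+
  thus ?thesis by (simp only: measure_empty mult_zero_left)
next
  case True
  note iff = path_iff[of x, OF conjunct1[OF True] n]
  let ?J = "(\<lambda>i. code (x i)) ` {1..<n}" and ?k = "code (x n)"
  define A where "A k = {z \<in> space (successor k). \<forall>i\<in>{1..<n}. code (x i) = k \<longrightarrow> z = x (Suc i)}" for k
  \<comment> \<open>Both path events are cylinders, and \<open>B\<close> differs from \<open>A\<close> only in the coordinate of \<open>x n\<close>.\<close>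
  define B where "B = A(?k := {y} \<inter> set_pmf (K (x n)))"
  have k: "?k \<notin> ?J"
  proof
    assume "?k \<in> ?J"
    then obtain i where i: "1 \<le> i" "i < n" "code (x n) = code (x i)" by auto
    hence "x i \<in> S i" "x n \<in> S n" using True n by auto
    moreover from this have "x i = x n" using i(3) decode by metis
    ultimately show False using disjoint_states[of "x n" i n] i(2) by simp
  qed
  have "x n \<in> S n" using True n by auto
  hence dec: "decode ?k = x n" by (rule decode)
  have A: "A k \<in> sets (successor k)" and B: "B k \<in> sets (successor k)" for k
    using dec by (auto simp: A_def B_def sets_successor space_successor)
  have B_J: "B k = A k" if "k \<in> ?J" for k
    using that k unfolding B_def by (metis fun_upd_other)
  have A_iff: "(\<forall>k\<in>?J. \<omega> k \<in> A k) \<longleftrightarrow> (\<forall>i\<in>{1..n}. X i \<omega> = x i)" if "\<omega> \<in> space M" for \<omega>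
  proof -
    have "\<omega> k \<in> space (successor k)" for k using that by (simp add: space_M space_successor)
    hence "(\<forall>k\<in>?J. \<omega> k \<in> A k) \<longleftrightarrow> (\<forall>k\<in>?J. \<forall>i\<in>{1..<n}. code (x i) = k \<longrightarrow> \<omega> k = x (Suc i))"
      by (simp add: A_def)
    also have "\<dots> \<longleftrightarrow> (\<forall>i\<in>{1..<n}. \<omega> (code (x i)) = x (Suc i))" by simp metis
    finally show ?thesis unfolding iff .
  qed
  have B_iff: "(\<forall>k\<in>insert ?k ?J. \<omega> k \<in> B k) \<longleftrightarrow> (\<forall>i\<in>{1..n}. X i \<omega> = x i) \<and> X (Suc n) \<omega> = y"
    if "\<omega> \<in> space M" for \<omega>
  proof -
    have "(\<forall>k\<in>insert ?k ?J. \<omega> k \<in> B k) \<longleftrightarrow> \<omega> ?k \<in> B ?k \<and> (\<forall>k\<in>?J. \<omega> k \<in> A k)"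
      unfolding ball_simps(7) using B_J by simp
    also have "\<omega> ?k \<in> B ?k \<longleftrightarrow> \<omega> ?k = y"
    proof -
      have "\<omega> ?k \<in> set_pmf (K (x n))" using that dec unfolding space_M by metis
      thus ?thesis by (auto simp: B_def)
    qed
    finally show ?thesis using A_iff[OF that] X_Suc[OF n, of \<omega>] n by auto
  qed
  have "{\<omega> \<in> space M. (\<forall>i\<in>{1..n}. X i \<omega> = x i) \<and> X (Suc n) \<omega> = y}
      = {\<omega> \<in> space (PiM UNIV successor). \<forall>k\<in>insert ?k ?J. \<omega> k \<in> B k}" (is "?E = ?E'")
    unfolding M_def[symmetric] using B_iff by blast
  hence "emeasure M ?E = (\<Prod>k\<in>insert ?k ?J. emeasure (successor k) (B k))"
    using prod.emeasure_PiM_Collect[of "insert ?k ?J" B] B by (simp add: M_def)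
  also have "\<dots> = emeasure (successor ?k) (B ?k) * (\<Prod>k\<in>?J. emeasure (successor k) (B k))"
    using k by (intro prod.insert) auto
  also have "(\<Prod>k\<in>?J. emeasure (successor k) (B k)) = (\<Prod>k\<in>?J. emeasure (successor k) (A k))"
    using B_J by (intro prod.cong) auto
  also have "\<dots> = emeasure M {\<omega> \<in> space M. \<forall>i\<in>{1..n}. X i \<omega> = x i}"
  proof -
    have "{\<omega> \<in> space M. \<forall>i\<in>{1..n}. X i \<omega> = x i} = {\<omega> \<in> space (PiM UNIV successor). \<forall>k\<in>?J. \<omega> k \<in> A k}"
      unfolding M_def[symmetric] using A_iff by blast
    thus ?thesis using prod.emeasure_PiM_Collect[of ?J A] A by (simp add: M_def)
  qed
  finally have "measure M ?E = measure (successor ?k) (B ?k) * measure M {\<omega> \<in> space M. \<forall>i\<in>{1..n}. X i \<omega> = x i}"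
    by (simp add: measure_def enn2real_mult)
  also have "measure (successor ?k) (B ?k) = pmf (K (x n)) y"
    using measure_successor[of ?k "{y}"] dec by (simp add: B_def measure_pmf_single)
  finally show ?thesis by (simp add: mult.commute)
qed

text \<open>The transition probabilities given the path depend on its last state only; sum over the finitely many
  paths that end in \<open>a\<close>.\<close>

lemma prob_step:
  assumes n: "1 \<le> n"
  shows "measure M {\<omega> \<in> space M. X n \<omega> = a \<and> X (Suc n) \<omega> = y}
    = measure M {\<omega> \<in> space M. X n \<omega> = a} * pmf (K a) y"
proof -
  \<comment> \<open>The possible histories up to time \<open>n\<close> that end in \<open>a\<close>.\<close>
  define H where "H = {h \<in> PiE {1..n} S. h n = a}"
  let ?E = "\<lambda>h. {\<omega> \<in> space M. \<forall>i\<in>{1..n}. X i \<omega> = h i}"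
  let ?F = "\<lambda>h. {\<omega> \<in> space M. (\<forall>i\<in>{1..n}. X i \<omega> = h i) \<and> X (Suc n) \<omega> = y}"
  have fin: "finite H" unfolding H_def by (simp add: finite_PiE finite_states)
  have disj: "disjoint_family_on ?E H"
    unfolding disjoint_family_on_def
  proof (intro ballI impI)
    fix h h' assume "h \<in> H" "h' \<in> H" "h \<noteq> h'"
    then obtain i where "i \<in> {1..n}" "h i \<noteq> h' i" unfolding H_def by (metis (no_types, lifting) PiE_ext mem_Collect_eq)
    thus "?E h \<inter> ?E h' = {}" by auto
  qed
  hence disj': "disjoint_family_on ?F H" by (fastforce simp: disjoint_family_on_def)
  have hist: "\<exists>h\<in>H. \<forall>i\<in>{1..n}. X i \<omega> = h i" if "\<omega> \<in> space M" "X n \<omega> = a" for \<omega>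
    by (rule bexI[of _ "restrict (\<lambda>i. X i \<omega>) {1..n}"]) (use that n X_in_states in \<open>auto simp: H_def\<close>)
  have E_eq: "{\<omega> \<in> space M. X n \<omega> = a} = (\<Union>h\<in>H. ?E h)"
    using hist n by (auto simp: H_def)
  have F_eq: "{\<omega> \<in> space M. X n \<omega> = a \<and> X (Suc n) \<omega> = y} = (\<Union>h\<in>H. ?F h)"
    using hist n by (auto simp: H_def)
  have sets_F: "?F h \<in> sets M" for h
    using sets_path[of n h] sets_X[of "Suc n" y] by (intro sets.sets_Collect_conj) auto
  have "measure M (\<Union>h\<in>H. ?F h) = (\<Sum>h\<in>H. measure M (?F h))"
    by (rule M.finite_measure_finite_Union) (use fin sets_F disj' in auto)
  also have "\<dots> = (\<Sum>h\<in>H. measure M (?E h) * pmf (K a) y)"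
    by (intro sum.cong refl) (subst prob_path_step[OF n], simp add: H_def)
  also have "\<dots> = measure M (\<Union>h\<in>H. ?E h) * pmf (K a) y"
    unfolding sum_distrib_right[symmetric]
    by (subst M.finite_measure_finite_Union) (use fin sets_path disj in auto)
  finally show ?thesis unfolding E_eq F_eq .
qed

lemma prob_X:
  assumes "1 \<le> n"
  shows "measure M {\<omega> \<in> space M. X n \<omega> = y} = pmf (P n) y"
  using assms
proof (induction n arbitrary: y rule: dec_induct)
  case base
  have "{\<omega> \<in> space M. X 1 \<omega> = y} = (if y = root then space M else {})" by (auto simp: X_1)
  thus ?case using law_1 M.prob_space by (simp add: indicator_def)
next
  case (step n)
  let ?F = "\<lambda>a. {\<omega> \<in> space M. X n \<omega> = a \<and> X (Suc n) \<omega> = y}"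
  have "{\<omega> \<in> space M. X (Suc n) \<omega> = y} = (\<Union>a\<in>S n. ?F a)"
    using X_in_states step(1) by auto
  hence "measure M {\<omega> \<in> space M. X (Suc n) \<omega> = y} = (\<Sum>a\<in>S n. measure M (?F a))"
    using sets_X[OF step(1)] sets_X[of "Suc n" y]
    by (subst M.finite_measure_finite_Union[symmetric])
       (auto simp: finite_states disjoint_family_on_def intro!: sets.sets_Collect_conj)
  also have "\<dots> = (\<Sum>a\<in>S n. pmf (K a) y * pmf (P n) a)"
    using step by (simp add: prob_step mult.commute)
  also have "\<dots> = pmf (bind_pmf (P n) K) y"
    unfolding pmf_bind using law_support[OF step(1)] finite_states
    by (intro integral_measure_pmf_real[symmetric]) auto
  finally show ?case by (simp add: law_Suc[OF step(1)])
qed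

lemma markov_process_X: "markov_process M S X"
  unfolding markov_process_def
proof (intro conjI allI impI M.prob_space_axioms measurable_X)
  fix n x y
  assume n: "1 \<le> n" and pos: "0 < measure M {\<omega> \<in> space M. \<forall>i\<in>{1..n}. X i \<omega> = x i}"
  have "measure M {\<omega> \<in> space M. \<forall>i\<in>{1..n}. X i \<omega> = x i} \<le> measure M {\<omega> \<in> space M. X n \<omega> = x n}"
    using n by (intro M.finite_measure_mono sets_X) auto
  hence pos': "0 < measure M {\<omega> \<in> space M. X n \<omega> = x n}" using pos by linarith
  show "cond_prob M (\<lambda>\<omega>. X (Suc n) \<omega> = y) (\<lambda>\<omega>. \<forall>i\<in>{1..n}. X i \<omega> = x i)
      = cond_prob M (\<lambda>\<omega>. X (Suc n) \<omega> = y) (\<lambda>\<omega>. X n \<omega> = x n)"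
    using pos pos' prob_path_step[OF n, of x y] prob_step[OF n, of "x n" y]
    by (simp add: cond_prob_def conj_commute)
qed (use finite_states in \<open>auto simp: countable_finite\<close>)

lemma distr_X:
  assumes "1 \<le> n"
  shows "distr M (count_space (S n)) (X n) = point_measure (S n) (\<lambda>x. ennreal (pmf (P n) x))"
proof (rule measure_eqI_finite[of _ "S n"])
  fix a assume a: "a \<in> S n"
  have "emeasure (distr M (count_space (S n)) (X n)) {a} = emeasure M (X n -` {a} \<inter> space M)"
    by (rule emeasure_distr[OF measurable_X[OF assms]]) (simp add: a)
  also have "X n -` {a} \<inter> space M = {\<omega> \<in> space M. X n \<omega> = a}" by auto
  finally show "emeasure (distr M (count_space (S n)) (X n)) {a}
      = emeasure (point_measure (S n) (\<lambda>x. ennreal (pmf (P n) x))) {a}"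
    using a finite_states prob_X[OF assms, of a]
    by (simp add: M.emeasure_eq_measure emeasure_point_measure_finite)
qed (simp_all add: finite_states sets_point_measure)

end

section \<open>Conditioned trees form an increasing Markov process\<close>

text \<open>The law \<open>BGW\<^sub>n\<close> as a probability mass function (\<open>BGW_cond_eq_plane_law\<close>).\<close>

definition plane_law :: "nat pmf \<Rightarrow> nat \<Rightarrow> nat list set pmf" where
  "plane_law \<mu> n = map_pmf plane (tree_law (pmf \<mu>) 0 n)"

text \<open>Some \<open>k \<ge> 1\<close> has positive mass, and there are no internal zeros between \<open>0\<close> and \<open>k\<close>. Paths are
  therefore possible trees, so every size occurs with positive probability.\<close>

lemma pmf_1_pos:
  fixes \<mu> :: "nat pmf"
  assumes "0 < pmf \<mu> 0" "pmf \<mu> 0 < 1" "log_concave (pmf \<mu>)"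
  shows "0 < pmf \<mu> 1"
proof -
  have "\<exists>k\<in>set_pmf \<mu>. k \<noteq> 0"
  proof (rule ccontr)
    assume "\<not> ?thesis"
    hence "sum (pmf \<mu>) {0} = 1" by (intro sum_pmf_eq_1) auto
    thus False using assms(2) by simp
  qed
  then obtain k where "0 < pmf \<mu> k" "1 \<le> k" by (auto simp: pmf_positive_iff)
  thus ?thesis using log_concave_pos_between[OF assms(3,1), of k 1] by simp
qed

lemma pmf_plane_law:
  assumes "0 < pmf \<mu> 0" "0 < pmf \<mu> 1" "1 \<le> n"
  shows "pmf (plane_law \<mu> n) T = (if T \<in> plane_trees n then BGW \<mu> T / tree_weight (pmf \<mu>) 0 n else 0)"
proof -
  have pos: "0 < tree_weight (pmf \<mu>) 0 n" using assms by (intro tree_weight_0_pos) auto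
  have law: "pmf (tree_law (pmf \<mu>) 0 n) t
      = (if num_vertices t = n then weight (pmf \<mu>) 0 t / tree_weight (pmf \<mu>) 0 n else 0)" for t
    using assms(3) pos by (intro pmf_tree_law) auto
  show ?thesis
  proof (cases "T \<in> plane_trees n")
    case True
    then obtain t where "T = plane t" "num_vertices t = n" unfolding plane_trees_eq_image by auto
    thus ?thesis using True by (simp add: plane_law_def pmf_map_inj'[OF inj_plane] law BGW_plane)
  next
    case False
    have "num_vertices t = n" if "t \<in> set_pmf (tree_law (pmf \<mu>) 0 n)" for t
      using that by (auto simp: set_pmf_iff law split: if_splits)
    hence "T \<notin> set_pmf (plane_law \<mu> n)" using False by (auto simp: plane_law_def plane_trees_eq_image)
    thus ?thesis using False by (simp add: set_pmf_iff)
  qed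
qed

lemma set_plane_law:
  assumes "0 < pmf \<mu> 0" "0 < pmf \<mu> 1" "1 \<le> n"
  shows "set_pmf (plane_law \<mu> n) \<subseteq> plane_trees n"
  by (auto simp: set_pmf_iff pmf_plane_law[OF assms] split: if_splits)

lemma BGW_cond_eq_plane_law:
  assumes "0 < pmf \<mu> 0" "0 < pmf \<mu> 1" "1 \<le> n"
  shows "BGW_cond \<mu> n = point_measure (plane_trees n) (\<lambda>T. ennreal (pmf (plane_law \<mu> n) T))"
proof -
  have pos: "0 < tree_weight (pmf \<mu>) 0 n" using assms by (intro tree_weight_0_pos) auto
  \<comment> \<open>The normalising constant is identified without summing over trees: a probability mass function
    has total mass \<open>1\<close>.\<close>
  have "1 = (\<Sum>T\<in>plane_trees n. pmf (plane_law \<mu> n) T)"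
    by (rule sum_pmf_eq_1[symmetric, OF finite_plane_trees set_plane_law[OF assms]])
  also have "\<dots> = (\<Sum>T\<in>plane_trees n. BGW \<mu> T) / tree_weight (pmf \<mu>) 0 n"
    by (simp add: pmf_plane_law[OF assms] sum_divide_distrib)
  finally have "(\<Sum>T\<in>plane_trees n. BGW \<mu> T) = tree_weight (pmf \<mu>) 0 n" using pos by simp
  thus ?thesis unfolding BGW_cond_def point_measure_def
    by (intro density_cong) (auto simp: pmf_plane_law[OF assms])
qed

lemma plane_law_increasing:
  assumes "0 < pmf \<mu> 0" "0 < pmf \<mu> 1" "log_concave (pmf \<mu>)" "1 \<le> n"
  shows "rel_pmf (\<subseteq>) (plane_law \<mu> n) (plane_law \<mu> (Suc n))"
proof -
  have "rel_pmf embeds (tree_law (pmf \<mu>) 0 n) (tree_law (pmf \<mu>) 0 (Suc n))"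
    using assms by (intro tree_law_increasing tree_weight_0_pos) auto
  thus ?thesis unfolding plane_law_def pmf.rel_map
    by (rule pmf.rel_mono_strong) (rule embeds_imp_subset)
qed

theorem theorem1:
  fixes \<mu> :: "nat pmf"
  assumes "0 < pmf \<mu> 0" and "pmf \<mu> 0 < 1"
    and "log_concave (pmf \<mu>)"
  shows "\<exists>(M :: (nat \<Rightarrow> nat list set) measure) (T :: nat \<Rightarrow> (nat \<Rightarrow> nat list set) \<Rightarrow> nat list set).
           markov_process M plane_trees T \<and>
           (\<forall>n\<ge>1. distr M (count_space (plane_trees n)) (T n) = BGW_cond \<mu> n) \<and>
           (\<forall>\<omega>\<in>space M. \<forall>n\<ge>1. T n \<omega> \<subseteq> T (Suc n) \<omega>)"
proof -
  have \<mu>1: "0 < pmf \<mu> 1" by (rule pmf_1_pos[OF assms])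
  let ?P = "plane_law \<mu>"
  note support = set_plane_law[OF assms(1) \<mu>1]
  have "\<exists>k. bind_pmf (?P n) k = ?P (Suc n) \<and> (\<forall>T\<in>set_pmf (?P n). \<forall>T'\<in>set_pmf (k T). T \<subseteq> T')"
    if "1 \<le> n" for n
    by (rule rel_pmf_kernelE[OF plane_law_increasing[OF assms(1) \<mu>1 assms(3) that]]) blast
  then obtain k where k: "\<And>n. 1 \<le> n \<Longrightarrow> bind_pmf (?P n) (k n) = ?P (Suc n)"
    and k_sub: "\<And>n T T'. 1 \<le> n \<Longrightarrow> T \<in> set_pmf (?P n) \<Longrightarrow> T' \<in> set_pmf (k n T) \<Longrightarrow> T \<subseteq> T'"
    by metis
  define K where "K T = k (card T) T" for T
  have K: "K T = k n T" if "1 \<le> n" "T \<in> set_pmf (?P n)" for n T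
    using support[OF that(1)] that(2) by (auto simp: K_def plane_trees_def)
  have countable: "countable (\<Union>n. plane_trees n)"
    by (rule countable_UN) (simp_all add: countable_finite finite_plane_trees)
  interpret graded_kernel ?P K plane_trees "to_nat_on (\<Union>n. plane_trees n)"
    "from_nat_into (\<Union>n. plane_trees n)" "{[]}"
  proof
    show "?P 1 = return_pmf {[]}" by (simp add: plane_law_def tree_law_1)
    show "bind_pmf (?P n) K = ?P (Suc n)" if "1 \<le> n" for n
      using K[OF that] k[OF that] by (simp cong: bind_pmf_cong)
    show "from_nat_into (\<Union>n. plane_trees n) (to_nat_on (\<Union>n. plane_trees n) T) = T"
      if "T \<in> plane_trees n" for n T
      by (rule from_nat_into_to_nat_on[OF countable]) (use that in blast)
    show "m = n" if "T \<in> plane_trees m" "T \<in> plane_trees n" for m n T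
      using that by (simp add: plane_trees_def)
  qed (use support finite_plane_trees in auto)
  show ?thesis
  proof (intro exI conjI allI impI ballI)
    show "markov_process M plane_trees X" by (rule markov_process_X)
  next
    fix n :: nat assume "1 \<le> n"
    thus "distr M (count_space (plane_trees n)) (X n) = BGW_cond \<mu> n"
      by (simp add: distr_X BGW_cond_eq_plane_law[OF assms(1) \<mu>1])
  next
    fix \<omega> and n :: nat assume \<omega>: "\<omega> \<in> space M" and n: "1 \<le> n"
    note X = X_in_support[OF \<omega> n]
    show "X n \<omega> \<subseteq> X (Suc n) \<omega>"
      using X_Suc_in_kernel[OF \<omega> n] unfolding K[OF n X] by (rule k_sub[OF n X])
  qed
qed

end
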